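(* Let $G=SL_{n+1}(\mathbb C)$, $\mathbf i_0=(1,2,\ldots,n,\,1,2,\ldots,n-1,\,\ldots,\,1,2,3,\,1,2,\,1)$, and $c=(c_{1,1},\dots,c_{1,n},c_{2,1},\dots,c_{2,n-1},\dots,c_{n-1,1},c_{n-1,2},c_{n,1})\in(\mathbb C^\times)^{n(n+1)/2}$. Then for every $j\in\{1,\dots,n\}$: $$\Delta_{w_0\Lambda_j,s_j\Lambda_j}(\Theta^-_{\mathbf i_0}(c))=c_{n-j+1,1}+\frac{c_{n-j+1,2}}{c_{n-j+2,1}}+\frac{c_{n-j+1,3}}{c_{n-j+2,2}}+\cdots+\frac{c_{n-j+1,j}}{c_{n-j+2,j-1}},$$ $$\Delta_{w_0s_j\Lambda_j,\Lambda_j}(\Theta^-_{\mathbf i_0}(c))=\frac1{c_{j,1}}+\frac{c_{j-1,1}}{c_{j-1,2}}+\frac{c_{j-2,2}}{c_{j-2,3}}+\cdots+\frac{c_{1,j-1}}{c_{1,j}}.$$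
   Context: $T$ is the diagonal torus of $G=SL_{n+1}(\mathbb C)$, $U^+$ (resp. $U^-$) the upper (resp. lower) unitriangular matrices, $\Lambda_i$ the fundamental weights, $s_i$ the simple reflections, $w_0$ the longest Weyl group element. $x_i(c)=\exp(ce_i)$, $y_i(c)=\exp(cf_i)$, $\alpha_i^\vee(c)=c^{h_i}$ for Chevalley generators $e_i,f_i,h_i$; $\overline s_i=x_i(-1)y_i(1)x_i(-1)$ and $\overline w=\overline s_{j_1}\cdots\overline s_{j_l}$ for a reduced expression $w=s_{j_1}\cdots s_{j_l}$. Generalized minors: for a dominant weight $\mu$, $\Delta_\mu:G\to\mathbb C$ is the regular function with $\Delta_\mu(u^-tu^+)=\mu(t)$ for $u^\pm\in U^\pm$, $t\in T$; for Weyl group elements $u,v$, $\Delta_{u\mu,v\mu}(g)=\Delta_\mu(\overline u^{-1}g\,\overline v)$. Parametrization: $\mathbf y_i(c)=y_i(c)\alpha_i^\vee(c^{-1})$ and $\Theta^-_{\mathbf i_0}(c)$ is the product of the factors $\mathbf y_l(c_{k,l})$ in the order of $\mathbf i_0$: $\Theta^-_{\mathbf i_0}(c)=\mathbf y_1(c_{1,1})\mathbf y_2(c_{1,2})\cdots\mathbf y_n(c_{1,n})\,\mathbf y_1(c_{2,1})\cdots\mathbf y_{n-1}(c_{2,n-1})\cdots\mathbf y_1(c_{n,1})$.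
   Formalization: In the second identity the left side is taken at n−j+1 instead of j: Δ_{w0 s_i Λ_i, Λ_i} with i=n−j+1; as printed it fails, e.g. for n=2, j=1 the minor is 1/c_{2,1}+c_{1,1}/c_{1,2}, not 1/c_{1,1}. *)

theory Defs
  imports "Jordan_Normal_Form.Determinant" "HOL-Combinatorics.Permutations"
begin

text \<open>
  Matrices are indexed from 0 (rows and columns \<open>0..n\<close>), whereas the Dynkin nodes are
  \<open>1..n\<close> and the Weyl group permutes \<open>{1..n+1}\<close>.
  The node \<open>i\<close> thus lives on the matrix rows and columns \<open>i - 1\<close> and \<open>i\<close>.
\<close>

definition SL :: "nat \<Rightarrow> complex mat monoid" where
  "SL n = \<lparr>carrier = {g \<in> carrier_mat (n + 1) (n + 1). det g = 1},
           mult = (*), one = 1\<^sub>m (n + 1)\<rparr>"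

definition torus :: "nat \<Rightarrow> complex mat set" where
  "torus n = {t \<in> carrier (SL n). \<forall>i\<le>n. \<forall>j\<le>n. i \<noteq> j \<longrightarrow> t $$ (i, j) = 0}"

definition U_plus :: "nat \<Rightarrow> complex mat set" where
  "U_plus n = {u \<in> carrier (SL n).
     (\<forall>i\<le>n. u $$ (i, i) = 1) \<and> (\<forall>i\<le>n. \<forall>j<i. u $$ (i, j) = 0)}"

definition U_minus :: "nat \<Rightarrow> complex mat set" where
  "U_minus n = {u \<in> carrier (SL n).
     (\<forall>i\<le>n. u $$ (i, i) = 1) \<and> (\<forall>j\<le>n. \<forall>i<j. u $$ (i, j) = 0)}"

definition chev_e :: "nat \<Rightarrow> nat \<Rightarrow> complex mat" where
  "chev_e n i = mat (n + 1) (n + 1) (\<lambda>(a, b). if a = i - 1 \<and> b = i then 1 else 0)"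

definition chev_f :: "nat \<Rightarrow> nat \<Rightarrow> complex mat" where
  "chev_f n i = mat (n + 1) (n + 1) (\<lambda>(a, b). if a = i \<and> b = i - 1 then 1 else 0)"

text \<open>The diagonal entries of \<open>h\<^sub>i = [e\<^sub>i, f\<^sub>i]\<close>, kept as integers so that they can serve
  as exponents in \<open>c\<^sup>h\<close>.\<close>

definition chev_h_diag :: "nat \<Rightarrow> nat \<Rightarrow> int" where
  "chev_h_diag i a = (if a = i - 1 then 1 else if a = i then -1 else 0)"

text \<open>The exponential series, entry by entry.\<close>

definition mat_exp :: "complex mat \<Rightarrow> complex mat" where
  "mat_exp A = mat (dim_row A) (dim_row A) (\<lambda>(a, b). \<Sum>k. (A ^\<^sub>m k) $$ (a, b) / fact k)"

definition x_sub :: "nat \<Rightarrow> nat \<Rightarrow> complex \<Rightarrow> complex mat" where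
  "x_sub n i c = mat_exp (c \<cdot>\<^sub>m chev_e n i)"

definition y_sub :: "nat \<Rightarrow> nat \<Rightarrow> complex \<Rightarrow> complex mat" where
  "y_sub n i c = mat_exp (c \<cdot>\<^sub>m chev_f n i)"

definition coroot :: "nat \<Rightarrow> nat \<Rightarrow> complex \<Rightarrow> complex mat" where
  "coroot n i c =
     mat (n + 1) (n + 1) (\<lambda>(a, b). if a = b then c powi chev_h_diag i a else 0)"

definition mat_prod :: "nat \<Rightarrow> complex mat list \<Rightarrow> complex mat" where
  "mat_prod n As = foldr (*) As (1\<^sub>m (n + 1))"


text \<open>The Weyl group as the symmetric group on \<open>{1..n+1}\<close>.\<close>

definition weyl_group :: "nat \<Rightarrow> (nat \<Rightarrow> nat) set" where
  "weyl_group n = {w. w permutes {1..n + 1}}"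

definition s_refl :: "nat \<Rightarrow> nat \<Rightarrow> nat" where
  "s_refl i = Transposition.transpose i (i + 1)"

definition word_perm :: "nat list \<Rightarrow> nat \<Rightarrow> nat" where
  "word_perm js = foldr (\<lambda>j w. s_refl j \<circ> w) js id"

definition weyl_length :: "nat \<Rightarrow> (nat \<Rightarrow> nat) \<Rightarrow> nat" where
  "weyl_length n w =
     (LEAST l. \<exists>js. set js \<subseteq> {1..n} \<and> length js = l \<and> word_perm js = w)"

definition reduced_word :: "nat \<Rightarrow> (nat \<Rightarrow> nat) \<Rightarrow> nat list \<Rightarrow> bool" where
  "reduced_word n w js \<longleftrightarrow>
     set js \<subseteq> {1..n} \<and> word_perm js = w \<and> length js = weyl_length n w"

definition longest :: "nat \<Rightarrow> nat \<Rightarrow> nat" where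
  "longest n = (THE w. w \<in> weyl_group n \<and>
     (\<forall>v \<in> weyl_group n. weyl_length n v \<le> weyl_length n w))"

definition s_bar :: "nat \<Rightarrow> nat \<Rightarrow> complex mat" where
  "s_bar n i = x_sub n i (-1) * y_sub n i 1 * x_sub n i (-1)"

text \<open>The \<open>s_bar\<close> satisfy the braid relations, so the choice of the reduced word is
  immaterial.\<close>

definition w_bar :: "nat \<Rightarrow> (nat \<Rightarrow> nat) \<Rightarrow> complex mat" where
  "w_bar n w = mat_prod n (map (s_bar n) (SOME js. reduced_word n w js))"


text \<open>Regular functions on the affine variety \<open>SL\<close>: the algebra generated by the matrix
  entries. They are extensional (\<open>undefined\<close> off the group), so that functions agreeing on the
  group are equal.\<close>

inductive_set regular_fun :: "nat \<Rightarrow> (complex mat \<Rightarrow> complex) set" for n :: nat where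
  const: "(\<lambda>g\<in>carrier (SL n). a) \<in> regular_fun n"
| entry: "\<lbrakk>i \<le> n; j \<le> n\<rbrakk> \<Longrightarrow> (\<lambda>g\<in>carrier (SL n). g $$ (i, j)) \<in> regular_fun n"
| add: "\<lbrakk>p \<in> regular_fun n; q \<in> regular_fun n\<rbrakk>
    \<Longrightarrow> (\<lambda>g\<in>carrier (SL n). p g + q g) \<in> regular_fun n"
| mult: "\<lbrakk>p \<in> regular_fun n; q \<in> regular_fun n\<rbrakk>
    \<Longrightarrow> (\<lambda>g\<in>carrier (SL n). p g * q g) \<in> regular_fun n"

text \<open>Weights are represented by the characters of the torus that they define. The fundamental
  weight \<open>\<Lambda>\<^sub>i\<close> is the character dual to the coroots: it sends \<open>coroot n i c\<close> to \<open>c\<close> and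
  \<open>coroot n j c\<close> to 1 for \<open>j \<noteq> i\<close>.\<close>

definition fund_weight :: "nat \<Rightarrow> complex mat \<Rightarrow> complex" where
  "fund_weight i t = (\<Prod>k<i. t $$ (k, k))"

text \<open>Meaningful for dominant \<open>\<mu>\<close>, where such a regular function exists; it is unique because
  the image of \<open>U_minus n \<times> torus n \<times> U_plus n\<close> is Zariski dense in the group.\<close>

definition principal_minor ::
    "nat \<Rightarrow> (complex mat \<Rightarrow> complex) \<Rightarrow> complex mat \<Rightarrow> complex" where
  "principal_minor n \<mu> = (THE F. F \<in> regular_fun n \<and>
     (\<forall>u\<in>U_minus n. \<forall>t\<in>torus n. \<forall>v\<in>U_plus n. F (u * t * v) = \<mu> t))"

text \<open>\<open>gen_minor n \<mu> u v\<close> is the generalized minor with row weight \<open>u \<mu>\<close> and column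
  weight \<open>v \<mu>\<close>.\<close>

definition gen_minor ::
    "nat \<Rightarrow> (complex mat \<Rightarrow> complex) \<Rightarrow> (nat \<Rightarrow> nat) \<Rightarrow> (nat \<Rightarrow> nat) \<Rightarrow> complex mat \<Rightarrow> complex" where
  "gen_minor n \<mu> u v g = principal_minor n \<mu> (inv\<^bsub>SL n\<^esub> (w_bar n u) * g * w_bar n v)"


definition y_bold :: "nat \<Rightarrow> nat \<Rightarrow> complex \<Rightarrow> complex mat" where
  "y_bold n i c = y_sub n i c * coroot n i (inverse c)"

text \<open>The index pairs of the coordinates \<open>c\<^sub>k\<^sub>,\<^sub>l\<close> in the order of the product; their second
  components form the word \<open>1, \<dots>, n, 1, \<dots>, n - 1, \<dots>, 1, 2, 1\<close>.\<close>

definition index_pairs :: "nat \<Rightarrow> (nat \<times> nat) list" where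
  "index_pairs n = concat (map (\<lambda>k. map (Pair k) [1..<n + 2 - k]) [1..<n + 1])"

definition Theta_minus :: "nat \<Rightarrow> (nat \<Rightarrow> nat \<Rightarrow> complex) \<Rightarrow> complex mat" where
  "Theta_minus n c = mat_prod n (map (\<lambda>(k, l). y_bold n l (c k l)) (index_pairs n))"

end

(* With W the lift of the longest element, Theta_minus = A W B for upper unitriangular A and B,
   that is, Theta_minus = W L B with L the (lower unitriangular) conjugate of A by W. Since the
   generalized minors of a fundamental weight are leading minors, the two minors of the theorem
   are the entry of B and, up to sign, the entry of L next to the diagonal.

   The k-th block of factors of Theta_minus is bidiagonal with subdiagonal entries 1. Multiplying
   the blocks up from the right, every step moves the superdiagonal of A one place down
   and adds the diagonal of the block to it, while B gains one new column. *)

theory Submission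
  imports Defs "Jordan_Normal_Form.Char_Poly"
begin

section \<open>Inversions and reduced words\<close>

text \<open>Two definitions stand between the matrices and the minors. \<open>w_bar\<close> picks an
  arbitrary reduced word, so the lift has to be seen to depend on \<open>w\<close> alone; counting
  inversions column by column gives its signs in closed form. \<open>principal_minor\<close> is a
  definite description over regular functions, so the leading minor must be shown to be the only
  regular function with the prescribed values on the products of triangular factors; every element
  of the group is a limit of such products.

  The form A W B arises because left multiplication by a block turns the longest element of one
  symmetric group into that of the next larger one. At each step one column of the middle factor
  fails to match, and the discrepancy has to be moved to its right, into B. This requires the first
  coordinate of the solution of a linear system with matrix A, hence the first row of the inverse of
  A; carrying that row along is what closes the recursion.

  Conjugation by W turns the Dynkin diagram around, so the superdiagonal entry of A at node j is
  read off by a minor at node n - j + 1.\<close>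

definition inversions :: "(nat \<Rightarrow> nat) \<Rightarrow> (nat \<times> nat) set" where
  "inversions w = {(a, b). a < b \<and> w b < w a}"

text \<open>This lets inversions be defined without mentioning \<open>n\<close>: a fixed point
  outside the interval is never out of order with anything.\<close>

lemma inversions_subset:
  assumes "w permutes {1..n + 1}"
  shows "inversions w \<subseteq> {(a, b). a \<in> {1..n + 1} \<and> b \<in> {1..n + 1} \<and> a < b}"
proof clarify
  fix a b assume "(a, b) \<in> inversions w"
  then have ab: "a < b" "w b < w a" by (auto simp: inversions_def)
  have out: "x \<notin> {1..n + 1} \<Longrightarrow> w x = x" for x using assms by (auto simp: permutes_def)
  have inn: "x \<in> {1..n + 1} \<Longrightarrow> w x \<in> {1..n + 1}" for x using permutes_in_image[OF assms] by blast
  have "a \<in> {1..n + 1}"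
    using ab out[of a] out[of b] inn[of b] by fastforce
  moreover have "b \<in> {1..n + 1}"
    using ab out[of a] out[of b] inn[of a] by fastforce
  ultimately show "a \<in> {1..n + 1} \<and> b \<in> {1..n + 1} \<and> a < b" using ab by blast
qed

lemma inversions_id: "inversions id = {}"
  by (auto simp: inversions_def)

lemma finite_inversions: "w permutes {1..n + 1} \<Longrightarrow> finite (inversions w)"
  by (rule finite_subset[OF inversions_subset], assumption)
    (rule finite_subset[of _ "{1..n + 1} \<times> {1..n + 1}"], auto)

lemma s_refl_permutes: "i \<in> {1..n} \<Longrightarrow> s_refl i permutes {1..n + 1}"
  unfolding s_refl_def by (rule permutes_swap_id) auto

lemma s_refl_apply: "s_refl i x = (if x = i then i + 1 else if x = i + 1 then i else x)"
  by (auto simp: s_refl_def Transposition.transpose_def)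

lemma s_refl_s_refl_comp: "s_refl i \<circ> (s_refl i \<circ> w) = w"
  by (auto simp: s_refl_apply fun_eq_iff)

lemma word_perm_Nil: "word_perm [] = id"
  by (simp only: word_perm_def foldr.simps id_apply)

lemma word_perm_Cons: "word_perm (i # js) = s_refl i \<circ> word_perm js"
  by (simp add: word_perm_def)

lemma word_perm_append: "word_perm (xs @ ys) = word_perm xs \<circ> word_perm ys"
  by (induction xs) (auto simp: word_perm_def)

lemma word_perm_permutes: "set js \<subseteq> {1..n} \<Longrightarrow> word_perm js permutes {1..n + 1}"
proof (induction js)
  case Nil
  then show ?case by (simp add: word_perm_def permutes_id[unfolded id_def] id_def)
next
  case (Cons i js)
  then show ?case unfolding word_perm_Cons
    by (intro permutes_compose s_refl_permutes) auto
qed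

text \<open>Left multiplication swaps the values \<open>i\<close> and \<open>i + 1\<close>. No third
  value lies between them, so the comparison of the positions \<open>p\<close> and \<open>q\<close>
  is the only one that changes.\<close>

lemma inversions_s_refl_comp:
  assumes "w permutes S" "w p = i" "w q = i + 1" "p < q"
  shows "inversions (s_refl i \<circ> w) = insert (p, q) (inversions w)" "(p, q) \<notin> inversions w"
proof -
  have inj: "w a = w b \<longleftrightarrow> a = b" for a b
    using permutes_inj[OF assms(1)] by (auto dest: injD)
  have "(a, b) \<in> inversions (s_refl i \<circ> w) \<longleftrightarrow> (a, b) \<in> insert (p, q) (inversions w)" for a b
    using assms inj[of a p] inj[of a q] inj[of b p] inj[of b q] inj[of a b]
    by (auto simp: inversions_def s_refl_apply)
  then show "inversions (s_refl i \<circ> w) = insert (p, q) (inversions w)" by auto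
  show "(p, q) \<notin> inversions w" using assms by (auto simp: inversions_def)
qed

text \<open>The direction depends on which of the values \<open>i\<close> and \<open>i + 1\<close>
  comes first. The case \<open>down\<close> is the case \<open>up\<close> for
  \<open>s_refl i \<circ> w\<close>.\<close>

lemma s_refl_comp_cases:
  assumes w: "w permutes {1..n + 1}" and i: "i \<in> {1..n}"
  obtains
    (up) p q where "p < q" "w p = i" "w q = i + 1"
      "inversions (s_refl i \<circ> w) = insert (p, q) (inversions w)" "(p, q) \<notin> inversions w"
      "card (inversions (s_refl i \<circ> w)) = card (inversions w) + 1"
  | (down) p q where "q < p" "w p = i" "w q = i + 1"
      "card (inversions w) = card (inversions (s_refl i \<circ> w)) + 1"
proof -
  obtain p where p: "w p = i" using permutes_surj[OF w] by (metis surjD)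
  obtain q where q: "w q = i + 1" using permutes_surj[OF w] by (metis surjD)
  have w': "s_refl i \<circ> w permutes {1..n + 1}"
    by (rule permutes_compose[OF w s_refl_permutes[OF i]])
  consider "p < q" | "q < p" using p q by (metis linorder_neqE_nat n_not_Suc_n Suc_eq_plus1)
  then show ?thesis
  proof cases
    case 1
    note inv = inversions_s_refl_comp[OF w p q 1]
    show ?thesis by (rule up[OF 1 p q inv]) (simp add: inv finite_inversions[OF w])
  next
    case 2
    have "(s_refl i \<circ> w) q = i" "(s_refl i \<circ> w) p = i + 1" using p q by (auto simp: s_refl_apply)
    note inv = inversions_s_refl_comp[OF w' this 2, unfolded s_refl_s_refl_comp]
    show ?thesis by (rule down[OF 2 p q]) (simp only: inv(1) card_insert_disjoint[OF finite_inversions[OF w'] inv(2)] Suc_eq_plus1)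
  qed
qed

lemma card_inversions_word_perm_le:
  assumes "set js \<subseteq> {1..n}"
  shows "card (inversions (word_perm js)) \<le> length js"
  using assms
proof (induction js)
  case Nil
  then show ?case unfolding word_perm_Nil inversions_id by simp
next
  case (Cons i js)
  then have IH: "card (inversions (word_perm js)) \<le> length js" by simp
  have w: "word_perm js permutes {1..n + 1}" using Cons by (intro word_perm_permutes) auto
  have i: "i \<in> {1..n}" using Cons by auto
  from w i have "card (inversions (s_refl i \<circ> word_perm js)) \<le> length (i # js)"
    unfolding list.size by (cases rule: s_refl_comp_cases) (use IH in linarith)+
  then show ?case unfolding word_perm_Cons .
qed

text \<open>Both \<open>w\<close> and its inverse are strictly increasing on the naturals, so
  neither can lower a number.\<close>

lemma permutes_strict_mono_eq_id:
  fixes w :: "nat \<Rightarrow> nat"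
  assumes w: "w permutes S" and mono: "strict_mono w"
  shows "w = id"
proof
  fix x
  define winv where "winv = inv_into UNIV w"
  have "strict_mono winv"
  proof (rule strict_monoI)
    fix a b :: nat assume "a < b"
    then have "w (winv a) < w (winv b)" by (simp add: permutes_inverses[OF w] winv_def)
    then show "winv a < winv b" using mono by (simp add: strict_mono_less)
  qed
  then have "w x \<le> winv (w x)" by (rule strict_mono_imp_increasing)
  moreover have "x \<le> w x" by (rule strict_mono_imp_increasing[OF mono])
  ultimately show "w x = id x" by (simp add: permutes_inverses[OF w] winv_def)
qed

lemma inversions_empty_imp_id:
  assumes w: "w permutes S" and inv: "inversions w = {}"
  shows "w = id"
proof (rule permutes_strict_mono_eq_id[OF w], rule strict_monoI)
  fix a b :: nat assume "a < b"
  moreover have "(a, b) \<notin> inversions w" using inv by simp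
  moreover have "w a \<noteq> w b" using \<open>a < b\<close> permutes_inj[OF w] by (auto dest: injD)
  ultimately show "w a < w b" by (auto simp: inversions_def)
qed

text \<open>Induction on the number of inversions: a permutation other than the identity has some
  value \<open>i + 1\<close> standing before \<open>i\<close>, and swapping the two removes one
  inversion.\<close>

lemma exists_word_of_inversions:
  assumes "w permutes {1..n + 1}"
  shows "\<exists>js. set js \<subseteq> {1..n} \<and> word_perm js = w \<and> length js = card (inversions w)"
  using assms
proof (induction "card (inversions w)" arbitrary: w rule: less_induct)
  case (less w)
  note w = less.prems
  show ?case
  proof (cases "w = id")
    case True
    then show ?thesis by (intro exI[of _ "[]"]) (simp only: word_perm_Nil inversions_id, simp)
  next
    case False
    define winv where "winv = inv_into UNIV w"
    \<comment> \<open>The descent is sought in the inverse because reflections multiply from the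
      left and so act on values.\<close>
    have "\<exists>i\<in>{1..n}. winv (i + 1) < winv i"
    proof (rule ccontr)
      assume "\<not> (\<exists>i\<in>{1..n}. winv (i + 1) < winv i)"
      then have asc: "winv i \<le> winv (i + 1)" if "i \<in> {1..n}" for i using that by (metis not_le)
      have w': "winv permutes {1..n + 1}" unfolding winv_def by (rule permutes_inv[OF w])
      have inj: "winv i \<noteq> winv (i + 1)" for i
        using permutes_inj[OF w'] by (metis injD n_not_Suc_n Suc_eq_plus1)
      have out: "x \<notin> {1..n + 1} \<Longrightarrow> winv x = x" for x using w' by (auto simp: permutes_def)
      have inn: "x \<in> {1..n + 1} \<Longrightarrow> winv x \<in> {1..n + 1}" for x
        using permutes_in_image[OF w'] by blast
      have "winv i < winv (Suc i)" for i
      proof (cases "i \<in> {1..n}")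
        case True
        then show ?thesis using asc[of i] inj[of i] by simp
      next
        case False
        \<comment> \<open>These are the two ends of the interval and the range above it, where
          \<open>winv\<close> is the identity.\<close>
        then consider "i = 0" | "i = n + 1" | "i > n + 1" by fastforce
        then show ?thesis
          by cases (use out[of i] out[of "Suc i"] inn[of i] inn[of "Suc i"] in auto)
      qed
      then have "strict_mono winv" by (simp add: strict_mono_Suc_iff)
      then have "winv = id" by (rule permutes_strict_mono_eq_id[OF w'])
      then have "w = id" unfolding winv_def by (metis inv_id permutes_inv_inv w)
      then show False using False by simp
    qed
    then obtain i where i: "i \<in> {1..n}" and desc: "winv (i + 1) < winv i" by blast
    from w i show ?thesis
    proof (cases rule: s_refl_comp_cases)
      case (up p q)
      then have "winv i = p" "winv (i + 1) = q"
        unfolding winv_def using permutes_inv_eq[OF w] by blast+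
      then show ?thesis using desc up by simp
    next
      case (down p q)
      let ?v = "s_refl i \<circ> w"
      have "?v permutes {1..n + 1}" by (rule permutes_compose[OF w s_refl_permutes[OF i]])
      then obtain js where "set js \<subseteq> {1..n}" "word_perm js = ?v" "length js = card (inversions ?v)"
        using less.hyps[of ?v] down by auto
      then show ?thesis
        using i down by (intro exI[of _ "i # js"]) (auto simp: word_perm_Cons s_refl_s_refl_comp)
    qed
  qed
qed

text \<open>A letter changes the number of inversions by one, which bounds the length of every word
  from below; the word built by removing inversions attains the bound.\<close>

lemma weyl_length_eq_card_inversions:
  assumes "w permutes {1..n + 1}"
  shows "weyl_length n w = card (inversions w)"
  unfolding weyl_length_def
proof (rule Least_equality)
  show "\<exists>js. set js \<subseteq> {1..n} \<and> length js = card (inversions w) \<and> word_perm js = w"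
    using exists_word_of_inversions[OF assms] by auto
qed (use card_inversions_word_perm_le in auto)

lemma reduced_word_iff:
  "reduced_word n w js \<longleftrightarrow>
     set js \<subseteq> {1..n} \<and> word_perm js = w \<and> length js = card (inversions w)"
  unfolding reduced_word_def
  using weyl_length_eq_card_inversions word_perm_permutes by auto

section \<open>The longest element as the order reversal\<close>

definition reversal :: "nat \<Rightarrow> nat \<Rightarrow> nat" where
  "reversal n a = (if a \<in> {1..n + 1} then n + 2 - a else a)"

lemma reversal_permutes: "reversal n permutes {1..n + 1}"
proof (rule bij_imp_permutes)
  show "bij_betw (reversal n) {1..n + 1} {1..n + 1}"
    by (rule bij_betw_byWitness[of _ "reversal n"]) (auto simp: reversal_def)
qed (auto simp: reversal_def)

lemma inversions_reversal:
  "inversions (reversal n) = {(a, b). a \<in> {1..n + 1} \<and> b \<in> {1..n + 1} \<and> a < b}"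
  by (auto simp: inversions_def reversal_def split: if_splits)

text \<open>If \<open>w\<close> inverts every pair of the interval, the reversal applied after it
  restores all orders, and a permutation without inversions is the identity.\<close>

lemma eq_reversal_if_inversions_eq:
  assumes w: "w permutes {1..n + 1}" and inv: "inversions w = inversions (reversal n)"
  shows "w = reversal n"
proof -
  have rev_rev: "reversal n (reversal n x) = x" for x by (auto simp: reversal_def)
  have perm: "reversal n \<circ> w permutes {1..n + 1}"
    by (rule permutes_compose[OF w reversal_permutes])
  have inn: "w x \<in> {1..n + 1} \<longleftrightarrow> x \<in> {1..n + 1}" for x by (rule permutes_in_image[OF w])
  have "inversions (reversal n \<circ> w) = {}"
  proof (rule ccontr)
    assume "inversions (reversal n \<circ> w) \<noteq> {}"
    then obtain a b where ab: "(a, b) \<in> inversions (reversal n \<circ> w)" by auto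
    then have r: "a \<in> {1..n + 1}" "b \<in> {1..n + 1}" "a < b" using inversions_subset[OF perm] by auto
    then have "(a, b) \<in> inversions w" by (simp add: inv inversions_reversal)
    then have "w b < w a" by (simp add: inversions_def)
    then show False using ab inn[of a] inn[of b] r by (auto simp: inversions_def reversal_def)
  qed
  then have "reversal n \<circ> w = id" by (rule inversions_empty_imp_id[OF perm])
  then have "reversal n (w x) = x" for x by (metis comp_apply id_apply)
  then have "w x = reversal n x" for x using rev_rev by metis
  then show ?thesis by blast
qed

text \<open>The reversal inverts all pairs, so any permutation of maximal length inverts them all
  too; this gives the uniqueness that the definite description requires.\<close>

lemma longest_eq_reversal: "longest n = reversal n"
  unfolding longest_def
proof (rule the_equality)
  have len: "weyl_length n v \<le> weyl_length n (reversal n)" if "v permutes {1..n + 1}" for v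
    unfolding weyl_length_eq_card_inversions[OF that] weyl_length_eq_card_inversions[OF reversal_permutes]
    using inversions_subset[OF that]
    by (intro card_mono finite_inversions[OF reversal_permutes]) (simp add: inversions_reversal)
  then show "reversal n \<in> weyl_group n \<and>
      (\<forall>v\<in>weyl_group n. weyl_length n v \<le> weyl_length n (reversal n))"
    using reversal_permutes by (auto simp: weyl_group_def)
  fix w assume "w \<in> weyl_group n \<and> (\<forall>v\<in>weyl_group n. weyl_length n v \<le> weyl_length n w)"
  then have w: "w permutes {1..n + 1}" and max: "weyl_length n (reversal n) \<le> weyl_length n w"
    using reversal_permutes by (auto simp: weyl_group_def)
  have "inversions w = inversions (reversal n)"
  proof (rule card_seteq[OF finite_inversions[OF reversal_permutes]])
    show "inversions w \<subseteq> inversions (reversal n)"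
      using inversions_subset[OF w] by (simp add: inversions_reversal)
    show "card (inversions (reversal n)) \<le> card (inversions w)"
      using max unfolding weyl_length_eq_card_inversions[OF w]
        weyl_length_eq_card_inversions[OF reversal_permutes] .
  qed
  then show "w = reversal n" by (rule eq_reversal_if_inversions_eq[OF w])
qed

text \<open>Inversions are controlled under left multiplication, so the right factor is traded for a
  left one at the dual node: \<open>s_refl (n + 1 - j)\<close> applied after
  \<open>reversal n \<circ> s_refl j\<close> gives \<open>reversal n\<close>.\<close>

lemma card_inversions_reversal_s_refl:
  assumes "j \<in> {1..n}"
  shows "card (inversions (reversal n \<circ> s_refl j)) + 1 = card (inversions (reversal n))"
proof -
  let ?v = "reversal n \<circ> s_refl j"
  have v: "?v permutes {1..n + 1}"
    by (rule permutes_compose[OF s_refl_permutes[OF assms] reversal_permutes])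
  have "?v j = n + 1 - j" "?v (j + 1) = n + 1 - j + 1" "j < j + 1"
    using assms by (auto simp: reversal_def s_refl_apply)
  note inv = inversions_s_refl_comp[OF v this]
  have "s_refl (n + 1 - j) \<circ> ?v = reversal n"
  proof
    fix x
    show "(s_refl (n + 1 - j) \<circ> ?v) x = reversal n x"
      using assms by (cases "x = j"; cases "x = j + 1") (auto simp: reversal_def s_refl_apply)
  qed
  then show ?thesis
    using inv(1) card_insert_disjoint[OF finite_inversions[OF v] inv(2)]
    by (simp only: Suc_eq_plus1)
qed

section \<open>Lifts of Weyl group elements\<close>

lemma mat_mult_index:
  assumes "A \<in> carrier_mat N N" "B \<in> carrier_mat N N" "i < N" "j < N"
  shows "(A * B) $$ (i, j) = (\<Sum>k<N. A $$ (i, k) * B $$ (k, j))"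
  using assms by (auto simp: scalar_prod_def atLeast0LessThan intro!: sum.cong)

lemma det_upper_unitriangular:
  assumes A: "A \<in> carrier_mat N N" and "\<And>i. i < N \<Longrightarrow> A $$ (i, i) = 1"
    and "\<And>i j. i < N \<Longrightarrow> j < i \<Longrightarrow> A $$ (i, j) = 0"
  shows "det A = (1 :: complex)"
proof -
  have "upper_triangular A" using assms by auto
  then have "det A = prod_list (diag_mat A)" using A by (rule det_upper_triangular)
  also have "\<dots> = 1" using assms by (simp add: prod_list_diag_prod)
  finally show ?thesis .
qed

lemma det_lower_unitriangular:
  assumes A: "A \<in> carrier_mat N N" and "\<And>i. i < N \<Longrightarrow> A $$ (i, i) = 1"
    and "\<And>i j. j < N \<Longrightarrow> i < j \<Longrightarrow> A $$ (i, j) = 0"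
  shows "det A = (1 :: complex)"
proof -
  have "det A = prod_list (diag_mat A)" using assms by (intro det_lower_triangular) auto
  also have "\<dots> = 1" using assms by (simp add: prod_list_diag_prod)
  finally show ?thesis .
qed

section \<open>One-parameter subgroups and the lift of a simple reflection\<close>

lemma mat_exp_square_zero:
  assumes A: "A \<in> carrier_mat N N" and sq: "A * A = 0\<^sub>m N N"
  shows "mat_exp A = 1\<^sub>m N + A"
proof -
  have pow: "A ^\<^sub>m Suc (Suc k) = 0\<^sub>m N N" for k
  proof -
    have "A ^\<^sub>m Suc (Suc k) = A ^\<^sub>m k * (A * A)"
      using A by (simp add: assoc_mult_mat[of _ N N _ N _ N])
    then show ?thesis using A by (simp add: sq)
  qed
  have "(\<Sum>k. (A ^\<^sub>m k) $$ (a, b) / fact k) = (1\<^sub>m N + A) $$ (a, b)" if "a < N" "b < N" for a b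
  proof -
    have "(\<Sum>k. (A ^\<^sub>m k) $$ (a, b) / fact k) = (\<Sum>k\<in>{0, Suc 0}. (A ^\<^sub>m k) $$ (a, b) / fact k)"
    proof (rule suminf_finite)
      fix k :: nat assume "k \<notin> {0, Suc 0}"
      then obtain l where "k = Suc (Suc l)" by (metis insertCI old.nat.exhaust)
      then show "(A ^\<^sub>m k) $$ (a, b) / fact k = 0" using that by (simp only: pow) simp
    qed simp
    then show ?thesis using A that by simp
  qed
  then show ?thesis using A by (intro eq_matI) (auto simp: mat_exp_def)
qed

lemma x_sub_eq:
  assumes "i \<in> {1..n}"
  shows "x_sub n i c = mat (n + 1) (n + 1)
    (\<lambda>(a, b). if a = b then 1 else if a = i - 1 \<and> b = i then c else 0)"
proof -
  let ?A = "c \<cdot>\<^sub>m chev_e n i"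
  have A: "?A \<in> carrier_mat (n + 1) (n + 1)" by (simp add: chev_e_def)
  have "?A * ?A = 0\<^sub>m (n + 1) (n + 1)"
  proof (rule eq_matI)
    fix a b assume ab: "a < dim_row (0\<^sub>m (n + 1) (n + 1))" "b < dim_col (0\<^sub>m (n + 1) (n + 1))"
    have "(?A * ?A) $$ (a, b) = (\<Sum>k<n + 1. ?A $$ (a, k) * ?A $$ (k, b))"
      using A ab by (intro mat_mult_index) auto
    also have "\<dots> = 0" using ab assms by (intro sum.neutral) (auto simp: chev_e_def)
    finally show "(?A * ?A) $$ (a, b) = 0\<^sub>m (n + 1) (n + 1) $$ (a, b)" using ab by simp
  qed (use A in auto)
  then have "x_sub n i c = 1\<^sub>m (n + 1) + ?A" unfolding x_sub_def by (rule mat_exp_square_zero[OF A])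
  also have "\<dots> = mat (n + 1) (n + 1)
      (\<lambda>(a, b). if a = b then 1 else if a = i - 1 \<and> b = i then c else 0)"
    using assms by (intro eq_matI) (auto simp: chev_e_def)
  finally show ?thesis .
qed

lemma y_sub_eq:
  assumes "i \<in> {1..n}"
  shows "y_sub n i c = mat (n + 1) (n + 1)
    (\<lambda>(a, b). if a = b then 1 else if a = i \<and> b = i - 1 then c else 0)"
proof -
  let ?A = "c \<cdot>\<^sub>m chev_f n i"
  have A: "?A \<in> carrier_mat (n + 1) (n + 1)" by (simp add: chev_f_def)
  have "?A * ?A = 0\<^sub>m (n + 1) (n + 1)"
  proof (rule eq_matI)
    fix a b assume ab: "a < dim_row (0\<^sub>m (n + 1) (n + 1))" "b < dim_col (0\<^sub>m (n + 1) (n + 1))"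
    have "(?A * ?A) $$ (a, b) = (\<Sum>k<n + 1. ?A $$ (a, k) * ?A $$ (k, b))"
      using A ab by (intro mat_mult_index) auto
    also have "\<dots> = 0" using ab assms by (intro sum.neutral) (auto simp: chev_f_def)
    finally show "(?A * ?A) $$ (a, b) = 0\<^sub>m (n + 1) (n + 1) $$ (a, b)" using ab by simp
  qed (use A in auto)
  then have "y_sub n i c = 1\<^sub>m (n + 1) + ?A" unfolding y_sub_def by (rule mat_exp_square_zero[OF A])
  also have "\<dots> = mat (n + 1) (n + 1)
      (\<lambda>(a, b). if a = b then 1 else if a = i \<and> b = i - 1 then c else 0)"
    using assms by (intro eq_matI) (auto simp: chev_f_def)
  finally show ?thesis .
qed

lemma mult_transvection_index:
  fixes c :: complex
  assumes E: "E = mat N N (\<lambda>(a, b). if a = b then 1 else if a = p \<and> b = q then c else 0)"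
    and M: "M \<in> carrier_mat N N" and "p \<noteq> q" "q < N" "r < N" "a < N"
  shows "(E * M) $$ (r, a) = M $$ (r, a) + (if r = p then c * M $$ (q, a) else 0)"
proof -
  have "(E * M) $$ (r, a) = (\<Sum>k<N. E $$ (r, k) * M $$ (k, a))"
    using assms by (intro mat_mult_index) auto
  also have "\<dots> = (\<Sum>k<N. (if k = r then M $$ (k, a) else 0) +
      (if k = q then (if r = p then c * M $$ (k, a) else 0) else 0))"
    using assms by (intro sum.cong) auto
  also have "\<dots> = M $$ (r, a) + (if r = p then c * M $$ (q, a) else 0)"
    using assms by (simp add: sum.distrib)
  finally show ?thesis .
qed

lemma carrier_x_sub: "x_sub n i c \<in> carrier_mat (n + 1) (n + 1)"
  and carrier_y_sub: "y_sub n i c \<in> carrier_mat (n + 1) (n + 1)"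
  and carrier_s_bar: "s_bar n i \<in> carrier_mat (n + 1) (n + 1)"
  by (simp_all add: x_sub_def y_sub_def s_bar_def mat_exp_def chev_e_def chev_f_def carrier_matI)

text \<open>The three row operations send the rows \<open>(u, v)\<close> at \<open>i - 1\<close> and
  \<open>i\<close> to \<open>(u - v, v)\<close>, then \<open>(u - v, u)\<close>, then
  \<open>(- v, u)\<close>.\<close>

lemma s_bar_mult_index:
  assumes i: "i \<in> {1..n}" and M: "M \<in> carrier_mat (n + 1) (n + 1)" and r: "r \<le> n" "a \<le> n"
  shows "(s_bar n i * M) $$ (r, a) =
    (if r = i - 1 then - M $$ (i, a) else if r = i then M $$ (i - 1, a) else M $$ (r, a))"
proof -
  let ?N = "n + 1"
  note X = carrier_x_sub[of n i "-1"] and Y = carrier_y_sub[of n i 1]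
  let ?XM = "x_sub n i (-1) * M"
  let ?YXM = "y_sub n i 1 * ?XM"
  have XM: "?XM \<in> carrier_mat ?N ?N" and YXM: "?YXM \<in> carrier_mat ?N ?N"
    using mult_carrier_mat[OF X M] mult_carrier_mat[OF Y mult_carrier_mat[OF X M]] by simp_all
  have *: "s_bar n i * M = x_sub n i (-1) * ?YXM"
    unfolding s_bar_def
    by (simp only: assoc_mult_mat[OF mult_carrier_mat[OF X Y] X M] assoc_mult_mat[OF X Y XM])
  have xm: "?XM $$ (r, a) = M $$ (r, a) + (if r = i - 1 then (-1) * M $$ (i, a) else 0)"
    if "r \<le> n" for r
    using i M r that by (intro mult_transvection_index[OF x_sub_eq]) auto
  have yxm: "?YXM $$ (r, a) = ?XM $$ (r, a) + (if r = i then 1 * ?XM $$ (i - 1, a) else 0)"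
    if "r \<le> n" for r
    using i XM r that by (intro mult_transvection_index[OF y_sub_eq]) auto
  have "(s_bar n i * M) $$ (r, a) = ?YXM $$ (r, a) + (if r = i - 1 then (-1) * ?YXM $$ (i, a) else 0)"
    unfolding * using i YXM r by (intro mult_transvection_index[OF x_sub_eq]) auto
  then show ?thesis using i r by (auto simp: yxm xm)
qed

lemma s_bar_eq:
  assumes i: "i \<in> {1..n}"
  shows "s_bar n i = mat (n + 1) (n + 1) (\<lambda>(r, a). if r = i - 1 then (if a = i then -1 else 0)
    else if r = i then (if a = i - 1 then 1 else 0) else if r = a then 1 else 0)"
proof (rule eq_matI)
  fix r a
  let ?S = "mat (n + 1) (n + 1) (\<lambda>(r, a). if r = i - 1 then (if a = i then -1 else 0)
    else if r = i then (if a = i - 1 then 1 else 0) else if r = a then 1 else 0) :: complex mat"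
  assume "r < dim_row ?S" "a < dim_col ?S"
  then have "r \<le> n" "a \<le> n" by auto
  then have "(s_bar n i * 1\<^sub>m (n + 1)) $$ (r, a) = ?S $$ (r, a)"
    using i by (subst s_bar_mult_index) auto
  then show "s_bar n i $$ (r, a) = ?S $$ (r, a)"
    by (simp only: right_mult_one_mat[OF carrier_s_bar])
qed (use carrier_s_bar in auto)

section \<open>Lifts of reduced words as signed permutation matrices\<close>

definition signed_perm_mat :: "nat \<Rightarrow> (nat \<Rightarrow> nat) \<Rightarrow> complex mat" where
  "signed_perm_mat n w = mat (n + 1) (n + 1)
     (\<lambda>(r, a). if r + 1 = w (a + 1) then (-1) ^ card {b. (b, a + 1) \<in> inversions w} else 0)"

text \<open>The row that \<open>s_bar n i\<close> negates is the one moved up from \<open>i\<close>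
  to \<open>i - 1\<close>; its nonzero entry lies in the column of \<open>q\<close>. Because
  \<open>p < q\<close>, the one inversion created is \<open>(p, q)\<close>, which is counted in that
  same column, so sign and count stay in step.\<close>

lemma s_bar_mult_signed_perm_mat:
  assumes i: "i \<in> {1..n}" and w: "w permutes {1..n + 1}"
    and pq: "w p = i" "w q = i + 1" "p < q"
  shows "s_bar n i * signed_perm_mat n w = signed_perm_mat n (s_refl i \<circ> w)"
proof (rule eq_matI)
  let ?S = "signed_perm_mat n w" and ?S' = "signed_perm_mat n (s_refl i \<circ> w)"
  have S: "?S \<in> carrier_mat (n + 1) (n + 1)" by (simp add: signed_perm_mat_def)
  note inv = inversions_s_refl_comp[OF w pq]
  have at_p: "w x = i \<longleftrightarrow> x = p" and at_q: "w x = i + 1 \<longleftrightarrow> x = q" for x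
    using permutes_inj[OF w] pq by (metis injD)+
  fix r a
  assume "r < dim_row ?S'" "a < dim_col ?S'"
  then have ra: "r \<le> n" "a \<le> n" by (auto simp: signed_perm_mat_def)
  have "finite {b. (b, q) \<in> inversions w}"
    by (rule finite_subset[OF _ finite_imageI[OF finite_inversions[OF w], of fst]]) force
  moreover have "{b. (b, q) \<in> inversions (s_refl i \<circ> w)} = insert p {b. (b, q) \<in> inversions w}"
    unfolding inv(1) by auto
  ultimately have card_q: "card {b. (b, q) \<in> inversions (s_refl i \<circ> w)} =
      Suc (card {b. (b, q) \<in> inversions w})"
    using inv(2) by simp
  have card_x: "{b. (b, x) \<in> inversions (s_refl i \<circ> w)} = {b. (b, x) \<in> inversions w}"
    if "x \<noteq> q" for x
    unfolding inv(1) using that by auto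
  have idx: "?S $$ (s, a) = (if s + 1 = w (a + 1)
      then (-1) ^ card {b. (b, a + 1) \<in> inversions w} else 0)" if "s \<le> n" for s
    using that ra by (simp add: signed_perm_mat_def)
  have idx': "?S' $$ (r, a) = (if r + 1 = s_refl i (w (a + 1))
      then (-1) ^ card {b. (b, a + 1) \<in> inversions (s_refl i \<circ> w)} else 0)"
    using ra by (simp add: signed_perm_mat_def)
  have lhs: "(s_bar n i * ?S) $$ (r, a) =
      (if r = i - 1 then - ?S $$ (i, a) else if r = i then ?S $$ (i - 1, a) else ?S $$ (r, a))"
    by (rule s_bar_mult_index[OF i S ra])
  consider "a + 1 = q" | "a + 1 = p" | "a + 1 \<noteq> p" "a + 1 \<noteq> q" by blast
  then show "(s_bar n i * ?S) $$ (r, a) = ?S' $$ (r, a)"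
  proof cases
    case 1
    then show ?thesis unfolding lhs idx' using i ra card_q pq
      by (auto simp: idx s_refl_apply)
  next
    case 2
    then have c: "card {b. (b, a + 1) \<in> inversions (s_refl i \<circ> w)} =
        card {b. (b, a + 1) \<in> inversions w}" using card_x pq by simp
    have "w (a + 1) = i" using 2 pq by simp
    then show ?thesis unfolding lhs idx' c using i ra
      by (auto simp: idx s_refl_apply)
  next
    case 3
    then have c: "card {b. (b, a + 1) \<in> inversions (s_refl i \<circ> w)} =
        card {b. (b, a + 1) \<in> inversions w}" using card_x by simp
    have "w (a + 1) \<noteq> i" "w (a + 1) \<noteq> i + 1" using 3 at_p at_q by auto
    then show ?thesis unfolding lhs idx' c using i ra
      by (auto simp: idx s_refl_apply)
  qed
qed (use carrier_s_bar in \<open>auto simp: signed_perm_mat_def\<close>)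

lemma mat_prod_Nil: "mat_prod n [] = 1\<^sub>m (n + 1)"
  and mat_prod_Cons: "mat_prod n (A # As) = A * mat_prod n As"
  by (simp_all add: mat_prod_def)

lemma mat_prod_carrier:
  "set As \<subseteq> carrier_mat (n + 1) (n + 1) \<Longrightarrow> mat_prod n As \<in> carrier_mat (n + 1) (n + 1)"
  by (induction As) (auto simp: mat_prod_Nil mat_prod_Cons intro!: mult_carrier_mat)

lemma mat_prod_append:
  assumes "set As \<subseteq> carrier_mat (n + 1) (n + 1)" "set Bs \<subseteq> carrier_mat (n + 1) (n + 1)"
  shows "mat_prod n (As @ Bs) = mat_prod n As * mat_prod n Bs"
  using assms
proof (induction As)
  case Nil
  then show ?case using left_mult_one_mat[OF mat_prod_carrier] by (simp add: mat_prod_Nil)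
next
  case (Cons A As)
  then show ?case
    using assoc_mult_mat[OF _ mat_prod_carrier mat_prod_carrier, of A "n + 1" n As Bs]
    by (simp add: mat_prod_Cons)
qed

text \<open>In a reduced word every letter adds an inversion, since otherwise the tail would have
  more inversions than letters. The product therefore depends on \<open>w\<close> only, which makes
  the choice inside \<open>w_bar\<close> harmless.\<close>

lemma mat_prod_s_bar_reduced:
  assumes "reduced_word n w js"
  shows "mat_prod n (map (s_bar n) js) = signed_perm_mat n w"
  using assms
proof (induction js arbitrary: w)
  case Nil
  then have "w = id" by (simp add: reduced_word_iff word_perm_Nil)
  then show ?case
    unfolding signed_perm_mat_def \<open>w = id\<close> inversions_id
    by (auto simp: mat_prod_Nil intro!: eq_matI)
next
  case (Cons i js)
  let ?v = "word_perm js"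
  have js: "set js \<subseteq> {1..n}" and i: "i \<in> {1..n}" and w: "w = s_refl i \<circ> ?v"
    and len: "length (i # js) = card (inversions (s_refl i \<circ> ?v))"
    using Cons.prems unfolding reduced_word_iff word_perm_Cons by auto
  have v: "?v permutes {1..n + 1}" by (rule word_perm_permutes[OF js])
  have le: "card (inversions ?v) \<le> length js" by (rule card_inversions_word_perm_le[OF js])
  from v i show ?case
  proof (cases rule: s_refl_comp_cases)
    case (up p q)
    have "length js = card (inversions ?v)" using len up by simp
    then have "reduced_word n ?v js" using js unfolding reduced_word_iff by blast
    then have "mat_prod n (map (s_bar n) js) = signed_perm_mat n ?v" by (rule Cons.IH)
    then show ?thesis
      by (simp only: w list.map mat_prod_Cons s_bar_mult_signed_perm_mat[OF i v up(2,3,1)])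
  next
    case (down p q)
    then show ?thesis using len le by simp
  qed
qed

lemma w_bar_eq:
  assumes "reduced_word n w js"
  shows "w_bar n w = mat_prod n (map (s_bar n) js)"
proof -
  have "reduced_word n w (SOME js. reduced_word n w js)" using assms by (rule someI)
  then show ?thesis
    unfolding w_bar_def by (simp only: mat_prod_s_bar_reduced mat_prod_s_bar_reduced[OF assms])
qed

lemma w_bar_id: "w_bar n id = 1\<^sub>m (n + 1)"
proof -
  have "reduced_word n id []"
    unfolding reduced_word_iff word_perm_Nil inversions_id by simp
  then show ?thesis by (simp add: w_bar_eq mat_prod_Nil)
qed

lemma w_bar_s_refl:
  assumes j: "j \<in> {1..n}"
  shows "w_bar n (s_refl j) = s_bar n j"
proof -
  have "inversions (s_refl j \<circ> id) = insert (j, j + 1) (inversions id)"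
    using inversions_s_refl_comp(1)[OF permutes_id[of "{1..n + 1}"], of j j "j + 1"] by (simp add: id_def)
  then have "card (inversions (s_refl j)) = 1" by (simp add: inversions_id)
  moreover have "word_perm [j] = s_refl j" by (simp only: word_perm_Cons word_perm_Nil comp_id)
  ultimately have "reduced_word n (s_refl j) [j]" using j by (simp add: reduced_word_iff)
  then show ?thesis
    using right_mult_one_mat[OF carrier_s_bar] by (simp add: w_bar_eq mat_prod_Nil mat_prod_Cons)
qed

lemma exists_reduced_word:
  assumes "w permutes {1..n + 1}"
  obtains js where "reduced_word n w js"
  using exists_word_of_inversions[OF assms] unfolding reduced_word_iff by blast

lemma w_bar_longest:
  "w_bar n (longest n) =
     mat (n + 1) (n + 1) (\<lambda>(r, a). if r = n - a then (-1) ^ a else 0)"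
proof -
  obtain js where "reduced_word n (reversal n) js" by (rule exists_reduced_word[OF reversal_permutes])
  then have "w_bar n (longest n) = signed_perm_mat n (reversal n)"
    unfolding longest_eq_reversal by (simp add: w_bar_eq mat_prod_s_bar_reduced)
  also have "\<dots> = mat (n + 1) (n + 1) (\<lambda>(r, a). if r = n - a then (-1) ^ a else 0)"
  proof (rule eq_matI)
    fix r a
    assume "r < dim_row (mat (n + 1) (n + 1) (\<lambda>(r, a). if r = n - a then (-1) ^ a else 0 :: complex))"
      "a < dim_col (mat (n + 1) (n + 1) (\<lambda>(r, a). if r = n - a then (-1) ^ a else 0 :: complex))"
    then have ra: "r \<le> n" "a \<le> n" by auto
    \<comment> \<open>The reversal inverts \<open>a + 1\<close> with each of the \<open>a\<close>
      smaller indices, hence the sign \<open>(-1) ^ a\<close>.\<close>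
    then have "{b. (b, a + 1) \<in> inversions (reversal n)} = {1..a}"
      by (auto simp: inversions_reversal)
    then show "signed_perm_mat n (reversal n) $$ (r, a) =
        mat (n + 1) (n + 1) (\<lambda>(r, a). if r = n - a then (-1) ^ a else 0) $$ (r, a)"
      using ra by (auto simp: signed_perm_mat_def reversal_def)
  qed (auto simp: signed_perm_mat_def)
  finally show ?thesis .
qed

text \<open>Lifts multiply when lengths add: a reduced word of
  \<open>longest n \<circ> s_refl j\<close> followed by \<open>j\<close> is a reduced word of
  \<open>longest n\<close>.\<close>

lemma w_bar_longest_s_refl:
  assumes j: "j \<in> {1..n}"
  shows "w_bar n (longest n \<circ> s_refl j) * s_bar n j = w_bar n (longest n)"
proof -
  let ?v = "reversal n \<circ> s_refl j"
  have "?v permutes {1..n + 1}"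
    by (rule permutes_compose[OF s_refl_permutes[OF j] reversal_permutes])
  then obtain js where js: "reduced_word n ?v js" by (rule exists_reduced_word)
  have "word_perm (js @ [j]) = ?v \<circ> s_refl j"
    using js unfolding reduced_word_iff
    by (simp only: word_perm_append word_perm_Cons word_perm_Nil comp_id)
  also have "\<dots> = reversal n" by (auto simp: fun_eq_iff s_refl_apply)
  finally have "reduced_word n (reversal n) (js @ [j])"
    using js j card_inversions_reversal_s_refl[OF j] unfolding reduced_word_iff by auto
  then have "w_bar n (longest n) = mat_prod n (map (s_bar n) js @ map (s_bar n) [j])"
    unfolding longest_eq_reversal by (simp add: w_bar_eq)
  also have "\<dots> = mat_prod n (map (s_bar n) js) * mat_prod n (map (s_bar n) [j])"
    using carrier_s_bar by (intro mat_prod_append) auto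
  also have "\<dots> = w_bar n ?v * s_bar n j"
    using js right_mult_one_mat[OF carrier_s_bar] by (simp add: w_bar_eq mat_prod_Cons mat_prod_Nil)
  finally show ?thesis unfolding longest_eq_reversal by simp
qed

lemma det_s_bar:
  assumes "i \<in> {1..n}"
  shows "det (s_bar n i) = 1"
proof -
  have "det (x_sub n i c) = 1" for c
    using assms by (intro det_upper_unitriangular[OF carrier_x_sub]) (auto simp: x_sub_eq)
  moreover have "det (y_sub n i c) = 1" for c
    using assms by (intro det_lower_unitriangular[OF carrier_y_sub]) (auto simp: y_sub_eq)
  ultimately show ?thesis unfolding s_bar_def
    by (simp add: det_mult[OF mult_carrier_mat[OF carrier_x_sub carrier_y_sub] carrier_x_sub]
        det_mult[OF carrier_x_sub carrier_y_sub])
qed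

section \<open>The special linear group as a group containing the lifts\<close>

lemma carrier_SL: "g \<in> carrier (SL n) \<longleftrightarrow> g \<in> carrier_mat (n + 1) (n + 1) \<and> det g = 1"
  by (simp add: SL_def)

lemma mult_SL: "mult (SL n) = (*)" and one_SL: "one (SL n) = 1\<^sub>m (n + 1)"
  by (simp_all add: SL_def)

lemma group_SL: "group (SL n)"
proof (rule groupI)
  fix g assume "g \<in> carrier (SL n)"
  then have g: "g \<in> carrier_mat (n + 1) (n + 1)" "det g = 1" by (auto simp: carrier_SL)
  note adj = adj_mat[OF g(1)]
  have "adj_mat g * g = 1\<^sub>m (n + 1)" unfolding adj(3) g(2) by auto
  moreover from this have "det (adj_mat g) = 1"
    using det_mult[OF adj(1) g(1)] g(2) by simp
  ultimately show "\<exists>h\<in>carrier (SL n). h \<otimes>\<^bsub>SL n\<^esub> g = \<one>\<^bsub>SL n\<^esub>"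
    using adj(1) by (auto simp: carrier_SL mult_SL one_SL)
qed (auto simp: carrier_SL mult_SL one_SL det_mult assoc_mult_mat[of _ "n + 1" "n + 1" _ "n + 1" _ "n + 1"]
    simp flip: One_nat_def intro!: mult_carrier_mat)

lemma mat_prod_s_bar_SL:
  assumes "set js \<subseteq> {1..n}"
  shows "mat_prod n (map (s_bar n) js) \<in> carrier (SL n)"
  using assms
proof (induction js)
  case (Cons i js)
  then have "mat_prod n (map (s_bar n) js) \<in> carrier (SL n)" "s_bar n i \<in> carrier (SL n)"
    using carrier_s_bar det_s_bar by (auto simp: carrier_SL)
  then show ?case
    using monoid.m_closed[OF group.is_monoid[OF group_SL]] by (auto simp: mat_prod_Cons mult_SL)
qed (simp add: mat_prod_Nil carrier_SL)

lemma w_bar_SL: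
  assumes "w permutes {1..n + 1}"
  shows "w_bar n w \<in> carrier (SL n)"
proof -
  obtain js where js: "reduced_word n w js" by (rule exists_reduced_word[OF assms])
  then show ?thesis unfolding w_bar_eq[OF js] by (intro mat_prod_s_bar_SL) (simp add: reduced_word_iff)
qed

section \<open>Generalized minors of fundamental weights as leading minors\<close>

definition leading_block :: "nat \<Rightarrow> complex mat \<Rightarrow> complex mat" where
  "leading_block j g = mat j j (\<lambda>(a, b). g $$ (a, b))"

lemma carrier_leading_block: "leading_block j g \<in> carrier_mat j j"
  by (simp add: leading_block_def)

lemma leading_block_index: "a < j \<Longrightarrow> b < j \<Longrightarrow> leading_block j g $$ (a, b) = g $$ (a, b)"
  by (simp add: leading_block_def)

text \<open>Leading blocks multiply once the cross terms vanish. Stating this for products of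
  entries covers both a lower triangular left factor and an upper triangular right factor.\<close>

lemma leading_block_mult:
  assumes A: "A \<in> carrier_mat N N" and B: "B \<in> carrier_mat N N" and j: "j \<le> N"
    and zero: "\<And>a b k. a < j \<Longrightarrow> b < j \<Longrightarrow> j \<le> k \<Longrightarrow> k < N \<Longrightarrow> A $$ (a, k) * B $$ (k, b) = 0"
  shows "leading_block j (A * B) = leading_block j A * leading_block j B"
proof (rule eq_matI)
  fix a b assume "a < dim_row (leading_block j A * leading_block j B)"
    "b < dim_col (leading_block j A * leading_block j B)"
  then have ab: "a < j" "b < j" using carrier_leading_block by (auto simp: leading_block_def)
  have "leading_block j (A * B) $$ (a, b) = (\<Sum>k<N. A $$ (a, k) * B $$ (k, b))"
    using mat_mult_index[OF A B, of a b] ab j by (simp add: leading_block_index)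
  also have "\<dots> = (\<Sum>k<j. A $$ (a, k) * B $$ (k, b))"
    using j zero ab by (intro sum.mono_neutral_right) auto
  also have "\<dots> = (leading_block j A * leading_block j B) $$ (a, b)"
    using ab by (subst mat_mult_index[OF carrier_leading_block carrier_leading_block])
      (auto simp: leading_block_index)
  finally show "leading_block j (A * B) $$ (a, b) = (leading_block j A * leading_block j B) $$ (a, b)" .
qed (simp_all add: leading_block_def)

lemma det_leading_block_mult:
  assumes "A \<in> carrier_mat N N" "B \<in> carrier_mat N N" "j \<le> N"
    and "\<And>a b k. a < j \<Longrightarrow> b < j \<Longrightarrow> j \<le> k \<Longrightarrow> k < N \<Longrightarrow> A $$ (a, k) * B $$ (k, b) = 0"
  shows "det (leading_block j (A * B)) = det (leading_block j A) * det (leading_block j B)"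
  using leading_block_mult[OF assms] det_mult[OF carrier_leading_block carrier_leading_block] by simp

lemma U_plusD:
  assumes "u \<in> U_plus n"
  shows "u \<in> carrier_mat (n + 1) (n + 1)" "det u = 1" "\<And>i. i \<le> n \<Longrightarrow> u $$ (i, i) = 1"
    "\<And>i j. i \<le> n \<Longrightarrow> j < i \<Longrightarrow> u $$ (i, j) = 0"
  using assms by (auto simp: U_plus_def carrier_SL)

lemma U_minusD:
  assumes "u \<in> U_minus n"
  shows "u \<in> carrier_mat (n + 1) (n + 1)" "det u = 1" "\<And>i. i \<le> n \<Longrightarrow> u $$ (i, i) = 1"
    "\<And>i j. j \<le> n \<Longrightarrow> i < j \<Longrightarrow> u $$ (i, j) = 0"
  using assms by (auto simp: U_minus_def carrier_SL)

lemma torusD: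
  assumes "t \<in> torus n"
  shows "t \<in> carrier_mat (n + 1) (n + 1)" "det t = 1"
    "\<And>i j. i \<le> n \<Longrightarrow> j \<le> n \<Longrightarrow> i \<noteq> j \<Longrightarrow> t $$ (i, j) = 0"
  using assms by (auto simp: torus_def carrier_SL)

lemma U_plusI:
  assumes "u \<in> carrier_mat (n + 1) (n + 1)" "\<And>i. i \<le> n \<Longrightarrow> u $$ (i, i) = 1"
    "\<And>i j. i \<le> n \<Longrightarrow> j < i \<Longrightarrow> u $$ (i, j) = 0"
  shows "u \<in> U_plus n"
  using assms det_upper_unitriangular[OF assms(1)] by (auto simp: U_plus_def carrier_SL)

lemma U_minusI:
  assumes "u \<in> carrier_mat (n + 1) (n + 1)" "\<And>i. i \<le> n \<Longrightarrow> u $$ (i, i) = 1"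
    "\<And>i j. j \<le> n \<Longrightarrow> i < j \<Longrightarrow> u $$ (i, j) = 0"
  shows "u \<in> U_minus n"
  using assms det_lower_unitriangular[OF assms(1)] by (auto simp: U_minus_def carrier_SL)

lemma det_leading_block_U_plus:
  assumes "u \<in> U_plus n" "j \<le> n + 1"
  shows "det (leading_block j u) = 1"
  using U_plusD[OF assms(1)] assms(2)
  by (intro det_upper_unitriangular[OF carrier_leading_block]) (auto simp: leading_block_index)

lemma det_leading_block_U_minus:
  assumes "u \<in> U_minus n" "j \<le> n + 1"
  shows "det (leading_block j u) = 1"
  using U_minusD[OF assms(1)] assms(2)
  by (intro det_lower_unitriangular[OF carrier_leading_block]) (auto simp: leading_block_index)

lemma det_leading_block_torus:
  assumes "t \<in> torus n" "j \<le> n + 1"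
  shows "det (leading_block j t) = fund_weight j t"
proof -
  have "upper_triangular (leading_block j t)"
    using torusD(3)[OF assms(1)] assms(2) by (auto simp: leading_block_def)
  then have "det (leading_block j t) = prod_list (diag_mat (leading_block j t))"
    by (rule det_upper_triangular[OF _ carrier_leading_block])
  also have "\<dots> = fund_weight j t"
    by (simp add: prod_list_diag_prod fund_weight_def leading_block_def atLeast0LessThan)
  finally show ?thesis .
qed

lemma det_leading_block_gauss:
  assumes u: "u \<in> U_minus n" and t: "t \<in> torus n" and v: "v \<in> U_plus n" and j: "j \<le> n + 1"
  shows "det (leading_block j (u * t * v)) = fund_weight j t"
proof -
  note C = U_minusD(1)[OF u] torusD(1)[OF t] U_plusD(1)[OF v]
  have "det (leading_block j (u * t * v)) = det (leading_block j (u * t)) * det (leading_block j v)"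
    using j U_plusD(4)[OF v]
    by (intro det_leading_block_mult[OF mult_carrier_mat[OF C(1,2)] C(3)]) auto
  also have "det (leading_block j (u * t)) = det (leading_block j u) * det (leading_block j t)"
    using j U_minusD(4)[OF u] by (intro det_leading_block_mult[OF C(1,2)]) auto
  finally show ?thesis
    using det_leading_block_U_minus[OF u j] det_leading_block_U_plus[OF v j]
      det_leading_block_torus[OF t j] by simp
qed

section \<open>Regular functions: leading minors and continuity\<close>

lemma regular_fun_sum:
  assumes "finite S" "\<And>x. x \<in> S \<Longrightarrow> f x \<in> regular_fun n"
  shows "(\<lambda>g\<in>carrier (SL n). \<Sum>x\<in>S. f x g) \<in> regular_fun n"
  using assms
proof (induction S rule: finite_induct)
  case empty
  then show ?case using regular_fun.const[of 0 n] by (simp only: sum.empty)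
next
  case (insert x S)
  \<comment> \<open>Members of \<open>regular_fun\<close> are restricted to the group, so the
    partial sum has to enter in restricted form.\<close>
  have "(\<lambda>g\<in>carrier (SL n). f x g + (\<lambda>g\<in>carrier (SL n). \<Sum>x\<in>S. f x g) g) \<in> regular_fun n"
    using insert by (intro regular_fun.add) auto
  also have "(\<lambda>g\<in>carrier (SL n). f x g + (\<lambda>g\<in>carrier (SL n). \<Sum>x\<in>S. f x g) g) =
      (\<lambda>g\<in>carrier (SL n). \<Sum>x\<in>insert x S. f x g)"
    using insert by (auto simp: restrict_def)
  finally show ?case .
qed

lemma regular_fun_prod:
  assumes "finite S" "\<And>x. x \<in> S \<Longrightarrow> f x \<in> regular_fun n"
  shows "(\<lambda>g\<in>carrier (SL n). \<Prod>x\<in>S. f x g) \<in> regular_fun n"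
  using assms
proof (induction S rule: finite_induct)
  case empty
  then show ?case using regular_fun.const[of 1 n] by (simp only: prod.empty)
next
  case (insert x S)
  have "(\<lambda>g\<in>carrier (SL n). f x g * (\<lambda>g\<in>carrier (SL n). \<Prod>x\<in>S. f x g) g) \<in> regular_fun n"
    using insert by (intro regular_fun.mult) auto
  also have "(\<lambda>g\<in>carrier (SL n). f x g * (\<lambda>g\<in>carrier (SL n). \<Prod>x\<in>S. f x g) g) =
      (\<lambda>g\<in>carrier (SL n). \<Prod>x\<in>insert x S. f x g)"
    using insert by (auto simp: restrict_def)
  finally show ?case .
qed

text \<open>The Leibniz formula writes the minor as a polynomial in the matrix entries.\<close>

lemma regular_fun_leading_minor:
  assumes j: "j \<le> n + 1"
  shows "(\<lambda>g\<in>carrier (SL n). det (leading_block j g)) \<in> regular_fun n"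
proof -
  let ?S = "carrier (SL n)" and ?P = "{p. p permutes {0..<j}}"
  define e where "e p i = (\<lambda>g\<in>?S. g $$ (i, p i :: nat))" for p and i :: nat
  define f where "f p = (\<lambda>g\<in>?S. (\<lambda>g\<in>?S. signof p) g * (\<lambda>g\<in>?S. \<Prod>i\<in>{0..<j}. e p i g) g)" for p
  have "e p i \<in> regular_fun n" if p: "p \<in> ?P" and i: "i \<in> {0..<j}" for p i
  proof -
    have "p i \<in> {0..<j}" using permutes_in_image[of p "{0..<j}" i] p i by auto
    then show ?thesis unfolding e_def using i j by (intro regular_fun.entry) auto
  qed
  then have "f p \<in> regular_fun n" if "p \<in> ?P" for p
    unfolding f_def using that by (intro regular_fun.mult regular_fun.const regular_fun_prod) auto
  then have "(\<lambda>g\<in>?S. \<Sum>p\<in>?P. f p g) \<in> regular_fun n"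
    by (intro regular_fun_sum) (auto intro: finite_permutations)
  also have "(\<lambda>g\<in>?S. \<Sum>p\<in>?P. f p g) = (\<lambda>g\<in>?S. det (leading_block j g))"
  proof (rule restrict_ext)
    fix g assume g: "g \<in> ?S"
    have "p i < j" if "p \<in> ?P" "i < j" for p i
      using permutes_in_image[of p "{0..<j}" i] that by auto
    then show "(\<Sum>p\<in>?P. f p g) = det (leading_block j g)"
      unfolding det_def'[OF carrier_leading_block] using g
      by (intro sum.cong) (auto simp: f_def e_def leading_block_index intro!: prod.cong)
  qed
  finally show ?thesis .
qed

lemma regular_fun_undefined: "F \<in> regular_fun n \<Longrightarrow> g \<notin> carrier (SL n) \<Longrightarrow> F g = undefined"
  by (induction rule: regular_fun.induct) auto

text \<open>Polynomials in the entries are continuous. The family must eventually lie in the group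
  because elsewhere the functions take the value \<open>undefined\<close>.\<close>

lemma regular_fun_tendsto:
  assumes F: "F \<in> regular_fun n" and g: "g \<in> carrier (SL n)"
    and h: "eventually (\<lambda>e. h e \<in> carrier (SL n)) l"
    and lim: "\<And>i j. i \<le> n \<Longrightarrow> j \<le> n \<Longrightarrow> ((\<lambda>e. h e $$ (i, j)) \<longlongrightarrow> g $$ (i, j)) l"
  shows "((\<lambda>e. F (h e)) \<longlongrightarrow> F g) l"
proof -
  have restr: "((\<lambda>e. restrict p (carrier (SL n)) (h e)) \<longlongrightarrow> restrict p (carrier (SL n)) g) l"
    if p: "((\<lambda>e. p (h e)) \<longlongrightarrow> p g) l" for p :: "complex mat \<Rightarrow> complex"
  proof -
    have "eventually (\<lambda>e. restrict p (carrier (SL n)) (h e) = p (h e)) l"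
      using h by eventually_elim simp
    then show ?thesis using p g by (simp add: tendsto_cong)
  qed
  from F show ?thesis
    by (induction rule: regular_fun.induct)
      (intro restr tendsto_const tendsto_add tendsto_mult lim; assumption)+
qed

section \<open>Gauss decomposition and density of the triangular products\<close>

lemma exists_row_solution:
  fixes A :: "complex mat"
  assumes A: "A \<in> carrier_mat N N" and det: "det A \<noteq> 0"
  shows "\<exists>x. \<forall>b<N. (\<Sum>a<N. x a * A $$ (a, b)) = z b"
proof (intro exI allI impI)
  fix b assume b: "b < N"
  note adj = adj_mat[OF A]
  let ?x = "\<lambda>a. \<Sum>c<N. z c * adj_mat A $$ (c, a) / det A"
  have "(\<Sum>a<N. ?x a * A $$ (a, b)) = (\<Sum>c<N. z c / det A * (\<Sum>a<N. adj_mat A $$ (c, a) * A $$ (a, b)))"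
    unfolding sum_distrib_left sum_distrib_right by (subst sum.swap) (simp add: field_simps)
  also have "\<dots> = (\<Sum>c<N. if c = b then z c else 0)"
  proof (rule sum.cong)
    fix c assume "c \<in> {..<N}"
    then have "(\<Sum>a<N. adj_mat A $$ (c, a) * A $$ (a, b)) = (adj_mat A * A) $$ (c, b)"
      using mat_mult_index[OF adj(1) A] b by simp
    also have "\<dots> = (if c = b then det A else 0)" using adj(3) b \<open>c \<in> {..<N}\<close> by simp
    finally show "z c / det A * (\<Sum>a<N. adj_mat A $$ (c, a) * A $$ (a, b)) = (if c = b then z c else 0)"
      using det by simp
  qed simp
  also have "\<dots> = z b" using b by simp
  finally show "(\<Sum>a<N. ?x a * A $$ (a, b)) = z b" .
qed

text \<open>Forward substitution: row \<open>i\<close> of the equation expresses row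
  \<open>i\<close> of \<open>M\<close> through the rows above it.\<close>

lemma right_inverse_U_minus:
  assumes L: "L \<in> U_minus n" and M: "M \<in> carrier_mat (n + 1) (n + 1)"
    and LM: "L * M = 1\<^sub>m (n + 1)"
  shows "M \<in> U_minus n"
proof -
  have rec: "M $$ (i, j) = (if i = j then 1 else 0) - (\<Sum>k<i. L $$ (i, k) * M $$ (k, j))"
    if "i \<le> n" "j \<le> n" for i j
  proof -
    have "(if i = j then 1 else 0) = (\<Sum>k<n + 1. L $$ (i, k) * M $$ (k, j))"
      using mat_mult_index[OF U_minusD(1)[OF L] M, of i j] that by (simp add: LM)
    also have "\<dots> = (\<Sum>k<Suc i. L $$ (i, k) * M $$ (k, j))"
      using U_minusD(4)[OF L, of _ i] U_minusD(4)[OF L] that by (intro sum.mono_neutral_right) auto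
    also have "\<dots> = (\<Sum>k<i. L $$ (i, k) * M $$ (k, j)) + M $$ (i, j)"
      using U_minusD(3)[OF L] that by simp
    finally show ?thesis by (simp add: algebra_simps)
  qed
  have zero: "M $$ (i, j) = 0" if "i < j" "j \<le> n" for i j
    using that
  proof (induction i rule: less_induct)
    case (less i)
    then have "(\<Sum>k<i. L $$ (i, k) * M $$ (k, j)) = 0" by (intro sum.neutral) auto
    then show ?case using rec[of i j] less by simp
  qed
  moreover have "M $$ (i, i) = 1" if "i \<le> n" for i
  proof -
    have "(\<Sum>k<i. L $$ (i, k) * M $$ (k, i)) = 0" using zero that by (intro sum.neutral) auto
    then show ?thesis using rec[of i i] that by simp
  qed
  ultimately show ?thesis by (intro U_minusI M)
qed

text \<open>Row elimination: the multipliers for row \<open>i\<close> solve a linear system whose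
  matrix is the leading block of size \<open>i\<close>, so its minor must not vanish. The minor of
  size \<open>n + 1\<close> is \<open>det g\<close>, which is 1.\<close>

lemma gauss_decomposition:
  assumes g: "g \<in> carrier (SL n)" and minors: "\<And>k. k \<le> n \<Longrightarrow> det (leading_block k g) \<noteq> 0"
  shows "\<exists>u\<in>U_minus n. \<exists>t\<in>torus n. \<exists>v\<in>U_plus n. g = u * t * v"
proof -
  let ?N = "n + 1"
  have gc: "g \<in> carrier_mat ?N ?N" and gd: "det g = 1" using g by (auto simp: carrier_SL)
  have "\<forall>i. \<exists>x. i \<le> n \<longrightarrow> (\<forall>b<i. (\<Sum>a<i. x a * g $$ (a, b)) = - g $$ (i, b))"
  proof
    fix i
    show "\<exists>x. i \<le> n \<longrightarrow> (\<forall>b<i. (\<Sum>a<i. x a * g $$ (a, b)) = - g $$ (i, b))"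
    proof (cases "i \<le> n")
      case True
      from exists_row_solution[OF carrier_leading_block minors[OF True], of "\<lambda>b. - g $$ (i, b)"]
      obtain x where "\<forall>b<i. (\<Sum>a<i. x a * leading_block i g $$ (a, b)) = - g $$ (i, b)" by blast
      then have "\<forall>b<i. (\<Sum>a<i. x a * g $$ (a, b)) = - g $$ (i, b)" by (simp add: leading_block_index)
      then show ?thesis by blast
    qed auto
  qed
  then obtain x where x: "\<And>i b. i \<le> n \<Longrightarrow> b < i \<Longrightarrow> (\<Sum>a<i. x i a * g $$ (a, b)) = - g $$ (i, b)"
    by metis
  define L where "L = mat ?N ?N (\<lambda>(i, a). if a < i then x i a else if a = i then 1 else 0)"
  have L: "L \<in> U_minus n" by (rule U_minusI) (auto simp: L_def)
  note Lc = U_minusD(1)[OF L]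
  define R where "R = L * g"
  have Rc: "R \<in> carrier_mat ?N ?N" unfolding R_def by (rule mult_carrier_mat[OF Lc gc])
  have R0: "R $$ (i, b) = 0" if "i \<le> n" "b < i" for i b
  proof -
    have "R $$ (i, b) = (\<Sum>a<?N. L $$ (i, a) * g $$ (a, b))"
      unfolding R_def using that by (intro mat_mult_index[OF Lc gc]) auto
    also have "\<dots> = (\<Sum>a<Suc i. L $$ (i, a) * g $$ (a, b))"
      using U_minusD(4)[OF L] that by (intro sum.mono_neutral_right) auto
    also have "\<dots> = (\<Sum>a<i. x i a * g $$ (a, b)) + g $$ (i, b)"
      using that by (simp add: L_def)
    finally show ?thesis using x that by simp
  qed
  have "upper_triangular R" using R0 Rc by auto
  then have "det R = prod_list (diag_mat R)" by (rule det_upper_triangular[OF _ Rc])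
  moreover have "det R = 1" unfolding R_def using det_mult[OF Lc gc] gd U_minusD(2)[OF L] by simp
  ultimately have prodR: "(\<Prod>i<?N. R $$ (i, i)) = 1"
    using Rc by (simp add: prod_list_diag_prod atLeast0LessThan)
  have Rne: "R $$ (i, i) \<noteq> 0" if "i \<le> n" for i
  proof
    assume "R $$ (i, i) = 0"
    then have "(\<Prod>i<?N. R $$ (i, i)) = 0" using that by (intro prod_zero) auto
    then show False using prodR by (metis zero_neq_one)
  qed
  define t where "t = mat ?N ?N (\<lambda>(i, j). if i = j then R $$ (i, i) else 0)"
  have tc: "t \<in> carrier_mat ?N ?N" by (simp add: t_def)
  have "upper_triangular t" by (auto simp: t_def)
  then have "det t = prod_list (diag_mat t)" by (rule det_upper_triangular[OF _ tc])
  also have "\<dots> = (\<Prod>i<?N. R $$ (i, i))" by (simp add: prod_list_diag_prod t_def atLeast0LessThan)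
  finally have "det t = 1" using prodR by simp
  then have t: "t \<in> torus n" using tc by (auto simp: torus_def carrier_SL t_def)
  define v where "v = mat ?N ?N (\<lambda>(i, j). R $$ (i, j) / R $$ (i, i))"
  have v: "v \<in> U_plus n" using Rne R0 by (intro U_plusI) (auto simp: v_def)
  note vc = U_plusD(1)[OF v]
  have tv: "t * v = R"
  proof (rule eq_matI)
    fix i j assume "i < dim_row R" "j < dim_col R"
    then have ij: "i \<le> n" "j \<le> n" using Rc by auto
    have "(t * v) $$ (i, j) = (\<Sum>k<?N. t $$ (i, k) * v $$ (k, j))"
      using ij by (intro mat_mult_index[OF tc vc]) auto
    also have "\<dots> = (\<Sum>k<?N. if k = i then R $$ (i, j) else 0)"
      using ij Rne by (intro sum.cong) (auto simp: t_def v_def)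
    also have "\<dots> = R $$ (i, j)" using ij by simp
    finally show "(t * v) $$ (i, j) = R $$ (i, j)" .
  qed (use Rc tc vc in auto)
  define u where "u = adj_mat L"
  note adj = adj_mat[OF Lc, folded u_def, unfolded U_minusD(2)[OF L]]
  have Lu: "L * u = 1\<^sub>m ?N" and uL: "u * L = 1\<^sub>m ?N" unfolding adj by auto
  have u: "u \<in> U_minus n" by (rule right_inverse_U_minus[OF L adj(1) Lu])
  have "g = u * L * g" unfolding uL using gc by simp
  also have "\<dots> = u * (L * g)" by (rule assoc_mult_mat[OF adj(1) Lc gc])
  also have "\<dots> = u * (t * v)" by (simp add: tv R_def)
  also have "\<dots> = u * t * v" by (rule assoc_mult_mat[OF adj(1) tc vc, symmetric])
  finally show ?thesis using u t v by blast
qed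

lemma eventually_notin_finite_at:
  fixes a :: "'a :: t1_space"
  assumes "finite S"
  shows "eventually (\<lambda>x. x \<notin> S) (at a)"
proof -
  have "eventually (\<lambda>x. x \<noteq> s) (at a)" for s
  proof (cases "s = a")
    case True
    then show ?thesis by (simp add: eventually_at_filter)
  next
    case False
    then have "eventually (\<lambda>x. x \<noteq> s) (nhds a)" by (intro t1_space_nhds) auto
    then show ?thesis by (simp add: eventually_at_filter eventually_mono)
  qed
  then have "eventually (\<lambda>x. \<forall>s\<in>S. x \<noteq> s) (at a)"
    using assms by (intro eventually_ball_finite) auto
  then show ?thesis by (rule eventually_mono) auto
qed

text \<open>The determinant vanishes only at negated roots of the characteristic polynomial, which
  is monic and so has finitely many.\<close>

lemma eventually_det_shift_nonzero:
  fixes A :: "complex mat"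
  assumes A: "A \<in> carrier_mat k k"
  shows "eventually (\<lambda>e. det (A + e \<cdot>\<^sub>m 1\<^sub>m k) \<noteq> 0) (at 0)"
proof -
  have "char_poly A \<noteq> 0" using degree_monic_char_poly[OF A] by auto
  then have "finite (uminus ` {x. poly (char_poly A) x = 0})" by (intro finite_imageI poly_roots_finite)
  then have "eventually (\<lambda>e. e \<notin> uminus ` {x. poly (char_poly A) x = 0}) (at 0)"
    by (rule eventually_notin_finite_at)
  then show ?thesis
  proof eventually_elim
    case (elim e)
    then have "poly (char_poly A) (- e) \<noteq> 0" by (metis (mono_tags) image_eqI mem_Collect_eq minus_minus)
    then have "det (char_matrix A (- e)) \<noteq> 0"
      using eigenvalue_root_char_poly[OF A] eigenvalue_det[OF A] by simp
    then show ?case using A by (simp add: char_matrix_def)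
  qed
qed

text \<open>Shifting by a small multiple of the identity makes all leading minors nonzero; rescaling
  the first row then restores determinant 1.\<close>

lemma regular_fun_eqI:
  assumes F: "F \<in> regular_fun n" and F': "F' \<in> regular_fun n"
    and eq: "\<And>u t v. u \<in> U_minus n \<Longrightarrow> t \<in> torus n \<Longrightarrow> v \<in> U_plus n \<Longrightarrow>
      F (u * t * v) = F' (u * t * v)"
  shows "F = F'"
proof
  fix g
  let ?N = "n + 1"
  show "F g = F' g"
  proof (cases "g \<in> carrier (SL n)")
    case False
    then show ?thesis using regular_fun_undefined F F' by metis
  next
    case True
    then have gc: "g \<in> carrier_mat ?N ?N" and gd: "det g = 1" by (auto simp: carrier_SL)
    define s where "s e = g + e \<cdot>\<^sub>m 1\<^sub>m ?N" for e
    define h where "h e = multrow 0 (inverse (det (s e))) (s e)" for e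
    have sc: "s e \<in> carrier_mat ?N ?N" for e using gc by (simp add: s_def)
    have lim_s: "((\<lambda>e. s e $$ (i, j)) \<longlongrightarrow> g $$ (i, j)) (at 0)" if "i \<le> n" "j \<le> n" for i j
    proof -
      have "((\<lambda>e. g $$ (i, j) + e * (if i = j then 1 else 0)) \<longlongrightarrow> g $$ (i, j) + 0 * (if i = j then 1 else 0)) (at 0)"
        by (intro tendsto_intros)
      then show ?thesis using that gc by (simp add: s_def)
    qed
    have lim_det: "((\<lambda>e. det (s e)) \<longlongrightarrow> det g) (at 0)"
    proof -
      have "p i < ?N" if "p permutes {0..<?N}" "i < ?N" for p i
        using permutes_in_image[of p "{0..<?N}" i] that by auto
      then show ?thesis unfolding det_def'[OF sc] det_def'[OF gc]
        by (intro tendsto_sum tendsto_mult tendsto_prod tendsto_const lim_s) (auto simp: less_Suc_eq_le)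
    qed
    \<comment> \<open>Size \<open>n + 1\<close> is included because the rescaling divides by the
      full determinant.\<close>
    have ne: "eventually (\<lambda>e. \<forall>k\<in>{..n + 1}. det (leading_block k g + e \<cdot>\<^sub>m 1\<^sub>m k) \<noteq> 0) (at 0)"
      by (intro eventually_ball_finite ballI eventually_det_shift_nonzero carrier_leading_block) auto
    have block_s: "leading_block k (s e) = leading_block k g + e \<cdot>\<^sub>m 1\<^sub>m k" if "k \<le> ?N" for k e
      using that gc by (intro eq_matI) (auto simp: leading_block_def s_def)
    have block_full: "leading_block ?N A = A" if "A \<in> carrier_mat ?N ?N" for A
      using that by (intro eq_matI) (auto simp: leading_block_def)
    have ne_s: "eventually (\<lambda>e. \<forall>k\<le>?N. det (leading_block k (s e)) \<noteq> 0) (at 0)"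
      using ne by eventually_elim (auto simp: block_s)
    have good: "eventually (\<lambda>e. h e \<in> carrier (SL n) \<and> F (h e) = F' (h e)) (at 0)"
      using ne_s
    proof eventually_elim
      case (elim e)
      then have d: "det (s e) \<noteq> 0" using block_full[OF sc] by (metis order_refl)
      have hc: "h e \<in> carrier_mat ?N ?N" using sc[of e] by (simp add: h_def)
      have "det (h e) = 1" unfolding h_def using d by (subst det_multrow[OF _ sc]) auto
      then have h: "h e \<in> carrier (SL n)" using hc by (simp add: carrier_SL)
      have "det (leading_block k (h e)) \<noteq> 0" if "k \<le> n" for k
      \<comment> \<open>The empty minor is 1; every larger leading minor contains row 0 and so is
        multiplied by the same nonzero factor.\<close>
      proof (cases "k = 0")
        case True
        then show ?thesis using elim by (metis det_dim_zero carrier_leading_block zero_neq_one)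
      next
        case False
        have "leading_block k (h e) = multrow 0 (inverse (det (s e))) (leading_block k (s e))"
          using that sc[of e] by (intro eq_matI) (auto simp: h_def leading_block_def)
        then have "det (leading_block k (h e)) = inverse (det (s e)) * det (leading_block k (s e))"
          using det_multrow[OF _ carrier_leading_block] False by simp
        then show ?thesis using d elim that by simp
      qed
      then obtain u t v where "u \<in> U_minus n" "t \<in> torus n" "v \<in> U_plus n" "h e = u * t * v"
        using gauss_decomposition[OF h] by blast
      then show ?case using eq h by simp
    qed
    then have h_in: "eventually (\<lambda>e. h e \<in> carrier (SL n)) (at 0)" by (rule eventually_mono) simp
    have lim_h: "((\<lambda>e. h e $$ (i, j)) \<longlongrightarrow> g $$ (i, j)) (at 0)" if "i \<le> n" "j \<le> n" for i j
    proof (cases "i = 0")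
      case True
      have "((\<lambda>e. inverse (det (s e)) * s e $$ (0, j)) \<longlongrightarrow> inverse (det g) * g $$ (0, j)) (at 0)"
        using that gd by (intro tendsto_intros lim_det lim_s) auto
      moreover have "h e $$ (i, j) = inverse (det (s e)) * s e $$ (0, j)" for e
        using True that sc[of e] by (simp add: h_def)
      ultimately show ?thesis using True gd by simp
    next
      case False
      then have "h e $$ (i, j) = s e $$ (i, j)" for e using that sc[of e] by (simp add: h_def)
      then show ?thesis using lim_s[OF that] by simp
    qed
    have "((\<lambda>e. F (h e)) \<longlongrightarrow> F g) (at 0)" by (rule regular_fun_tendsto[OF F True h_in lim_h])
    moreover have "((\<lambda>e. F' (h e)) \<longlongrightarrow> F' g) (at 0)"
      by (rule regular_fun_tendsto[OF F' True h_in lim_h])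
    then have "((\<lambda>e. F (h e)) \<longlongrightarrow> F' g) (at 0)"
      by (rule Lim_transform_eventually) (use good in \<open>eventually_elim, simp\<close>)
    ultimately show ?thesis by (rule tendsto_unique[rotated]) simp
  qed
qed

text \<open>The leading minor fits the description by multiplicativity on triangular factors, and it
  is the only candidate because regular functions are determined by their values on such
  products.\<close>

lemma principal_minor_fund_weight:
  assumes j: "j \<le> n + 1"
  shows "principal_minor n (fund_weight j) = (\<lambda>g\<in>carrier (SL n). det (leading_block j g))"
  unfolding principal_minor_def
proof (rule the_equality)
  let ?F = "\<lambda>g\<in>carrier (SL n). det (leading_block j g)"
  have "u * t * v \<in> carrier (SL n)" if "u \<in> U_minus n" "t \<in> torus n" "v \<in> U_plus n" for u t v
    using that monoid.m_closed[OF group.is_monoid[OF group_SL]]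
    by (auto simp: U_minus_def torus_def U_plus_def mult_SL)
  then show F: "?F \<in> regular_fun n \<and>
      (\<forall>u\<in>U_minus n. \<forall>t\<in>torus n. \<forall>v\<in>U_plus n. ?F (u * t * v) = fund_weight j t)"
    using regular_fun_leading_minor[OF j] det_leading_block_gauss j by simp
  fix F assume "F \<in> regular_fun n \<and>
      (\<forall>u\<in>U_minus n. \<forall>t\<in>torus n. \<forall>v\<in>U_plus n. F (u * t * v) = fund_weight j t)"
  then show "F = ?F" using F by (intro regular_fun_eqI[of F n ?F]) auto
qed

section \<open>Factorization of the product of bidiagonal blocks\<close>

text \<open>The subdiagonal entry is 1 because the \<open>c\<close> of \<open>y_sub\<close> meets
  the \<open>inverse c\<close> of the coroot.\<close>

lemma y_bold_eq:
  assumes i: "i \<in> {1..n}" and c: "c \<noteq> 0"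
  shows "y_bold n i c = mat (n + 1) (n + 1) (\<lambda>(r, b).
    if r = b then (if b = i - 1 then 1 / c else if b = i then c else 1)
    else if r = i \<and> b = i - 1 then 1 else 0)"
proof (rule eq_matI)
  let ?R = "mat (n + 1) (n + 1) (\<lambda>(r, b).
    if r = b then (if b = i - 1 then 1 / c else if b = i then c else 1)
    else if r = i \<and> b = i - 1 then 1 else 0)"
  have K: "coroot n i (inverse c) \<in> carrier_mat (n + 1) (n + 1)" by (simp add: coroot_def)
  fix r b assume "r < dim_row ?R" "b < dim_col ?R"
  then have rb: "r \<le> n" "b \<le> n" by auto
  have "y_bold n i c $$ (r, b) = y_sub n i c $$ (r, b) * coroot n i (inverse c) $$ (b, b)"
  proof -
    have "y_bold n i c $$ (r, b) =
        (\<Sum>k<n + 1. y_sub n i c $$ (r, k) * coroot n i (inverse c) $$ (k, b))"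
      unfolding y_bold_def using rb by (intro mat_mult_index[OF carrier_y_sub K]) auto
    also have "\<dots> = (\<Sum>k<n + 1. if k = b then y_sub n i c $$ (r, b) * coroot n i (inverse c) $$ (b, b) else 0)"
      using rb by (intro sum.cong) (auto simp: coroot_def)
    also have "\<dots> = y_sub n i c $$ (r, b) * coroot n i (inverse c) $$ (b, b)" using rb by simp
    finally show ?thesis .
  qed
  then show "y_bold n i c $$ (r, b) = ?R $$ (r, b)"
    using i c rb by (auto simp: y_sub_eq coroot_def chev_h_diag_def power_int_minus divide_simps)
qed (use carrier_y_sub[of n i c] in \<open>simp_all add: y_bold_def coroot_def\<close>)

lemma carrier_y_bold: "y_bold n i c \<in> carrier_mat (n + 1) (n + 1)"
  unfolding y_bold_def by (intro mult_carrier_mat[OF carrier_y_sub]) (simp add: coroot_def)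

lemma mult_y_bold_index:
  assumes i: "i \<in> {1..n}" and c: "c \<noteq> 0" and M: "M \<in> carrier_mat (n + 1) (n + 1)"
    and rb: "r \<le> n" "b \<le> n"
  shows "(M * y_bold n i c) $$ (r, b) =
    (if b = i - 1 then M $$ (r, i - 1) / c + M $$ (r, i)
     else if b = i then c * M $$ (r, i) else M $$ (r, b))"
proof -
  have "(M * y_bold n i c) $$ (r, b) = (\<Sum>k<n + 1. M $$ (r, k) * y_bold n i c $$ (k, b))"
    using rb by (intro mat_mult_index[OF M carrier_y_bold]) auto
  also have "\<dots> = (\<Sum>k<n + 1.
      (if k = b then M $$ (r, b) * (if b = i - 1 then 1 / c else if b = i then c else 1) else 0) +
      (if k = i then (if b = i - 1 then M $$ (r, i) else 0) else 0))"
    using i rb by (intro sum.cong) (auto simp: y_bold_eq[OF i c])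
  also have "\<dots> = M $$ (r, b) * (if b = i - 1 then 1 / c else if b = i then c else 1) +
      (if b = i - 1 then M $$ (r, i) else 0)"
    using i rb by (simp add: sum.distrib)
  finally show ?thesis using i by auto
qed

text \<open>With the convention \<open>a 0 = 1\<close> the first diagonal entry
  \<open>1 / a 1\<close> has the same form as the next ones, and \<open>m = 0\<close> gives the
  identity.\<close>

definition bidiag :: "nat \<Rightarrow> (nat \<Rightarrow> complex) \<Rightarrow> nat \<Rightarrow> complex mat" where
  "bidiag n a m = mat (n + 1) (n + 1) (\<lambda>(r, b).
     if r = b then (if b < m then a b / a (b + 1) else if b = m then a m else 1)
     else if r = b + 1 \<and> b < m then 1 else 0)"

lemma carrier_bidiag: "bidiag n a m \<in> carrier_mat (n + 1) (n + 1)"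
  by (simp add: bidiag_def)

text \<open>Right multiplication by a letter touches two adjacent columns only: it turns the last
  entry \<open>a m\<close> into \<open>a m / a (m + 1)\<close>, puts a 1 below it and opens the next
  diagonal entry.\<close>

lemma mat_prod_y_bold_eq_bidiag:
  assumes "m \<le> n" "a 0 = 1" "\<And>l. 1 \<le> l \<Longrightarrow> l \<le> m \<Longrightarrow> a l \<noteq> 0"
  shows "mat_prod n (map (\<lambda>l. y_bold n l (a l)) [1..<m + 1]) = bidiag n a m"
  using assms
proof (induction m)
  case 0
  then show ?case by (auto simp: mat_prod_Nil bidiag_def intro!: eq_matI)
next
  case (Suc m)
  let ?y = "\<lambda>l. y_bold n l (a l)"
  have "mat_prod n (map ?y [1..<Suc m + 1]) = mat_prod n (map ?y [1..<m + 1] @ [?y (Suc m)])" by simp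
  also have "\<dots> = mat_prod n (map ?y [1..<m + 1]) * mat_prod n [?y (Suc m)]"
    using carrier_y_bold by (intro mat_prod_append) auto
  also have "\<dots> = bidiag n a m * y_bold n (Suc m) (a (Suc m))"
    using Suc right_mult_one_mat[OF carrier_y_bold] by (simp add: mat_prod_Cons mat_prod_Nil)
  also have "\<dots> = bidiag n a (Suc m)"
  proof (rule eq_matI)
    fix r b assume "r < dim_row (bidiag n a (Suc m))" "b < dim_col (bidiag n a (Suc m))"
    then have rb: "r \<le> n" "b \<le> n" by (auto simp: bidiag_def)
    show "(bidiag n a m * y_bold n (Suc m) (a (Suc m))) $$ (r, b) = bidiag n a (Suc m) $$ (r, b)"
      using Suc.prems rb by (subst mult_y_bold_index[OF _ _ carrier_bidiag]) (auto simp: bidiag_def)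
  qed (use carrier_y_bold[of n "Suc m" "a (Suc m)"] in \<open>auto simp: bidiag_def\<close>)
  finally show ?case .
qed

lemma bidiag_mult_index:
  assumes M: "M \<in> carrier_mat (n + 1) (n + 1)" and rq: "r \<le> n" "q \<le> n"
  shows "(bidiag n a m * M) $$ (r, q) =
    (if r < m then a r / a (r + 1) else if r = m then a m else 1) * M $$ (r, q) +
    (if 0 < r \<and> r \<le> m then M $$ (r - 1, q) else 0)"
proof -
  have "(bidiag n a m * M) $$ (r, q) = (\<Sum>k<n + 1. bidiag n a m $$ (r, k) * M $$ (k, q))"
    using rq by (intro mat_mult_index[OF carrier_bidiag M]) auto
  also have "\<dots> = (\<Sum>k<n + 1.
      (if k = r then (if r < m then a r / a (r + 1) else if r = m then a m else 1) * M $$ (r, q) else 0) +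
      (if k = r - 1 then (if 0 < r \<and> r \<le> m then M $$ (r - 1, q) else 0) else 0))"
    using rq by (intro sum.cong) (auto simp: bidiag_def)
  also have "\<dots> = (if r < m then a r / a (r + 1) else if r = m then a m else 1) * M $$ (r, q) +
      (if 0 < r \<and> r \<le> m then M $$ (r - 1, q) else 0)"
    unfolding sum.distrib using rq by (subst (1 2) sum.delta) auto
  finally show ?thesis .
qed

text \<open>The lift of the longest element of the group permuting the first \<open>m + 1\<close>
  coordinates; for \<open>m = n\<close> it is \<open>w_bar n (longest n)\<close>.\<close>

definition partial_longest :: "nat \<Rightarrow> nat \<Rightarrow> complex mat" where
  "partial_longest n m = mat (n + 1) (n + 1)
     (\<lambda>(r, b). if b \<le> m then (if r = m - b then (-1) ^ b else 0) else if r = b then 1 else 0)"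

lemma carrier_partial_longest: "partial_longest n m \<in> carrier_mat (n + 1) (n + 1)"
  by (simp add: partial_longest_def)

lemma mult_partial_longest_index:
  assumes M: "M \<in> carrier_mat (n + 1) (n + 1)" and rq: "r \<le> n" "q \<le> n" and m: "m \<le> n"
  shows "(M * partial_longest n m) $$ (r, q) = (if q \<le> m then (-1) ^ q * M $$ (r, m - q) else M $$ (r, q))"
proof -
  have "(M * partial_longest n m) $$ (r, q) = (\<Sum>k<n + 1. M $$ (r, k) * partial_longest n m $$ (k, q))"
    using rq by (intro mat_mult_index[OF M carrier_partial_longest]) auto
  also have "\<dots> = (\<Sum>k<n + 1. if k = (if q \<le> m then m - q else q)
      then (if q \<le> m then (-1) ^ q * M $$ (r, m - q) else M $$ (r, q)) else 0)"
    using rq by (intro sum.cong) (auto simp: partial_longest_def)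
  also have "\<dots> = (if q \<le> m then (-1) ^ q * M $$ (r, m - q) else M $$ (r, q))"
    using rq m by (subst sum.delta) auto
  finally show ?thesis .
qed

lemma exists_column_solution:
  fixes A :: "complex mat"
  assumes A: "A \<in> carrier_mat N N" and det: "det A \<noteq> 0"
  shows "\<exists>y. \<forall>i<N. (\<Sum>k<N. A $$ (i, k) * y k) = z i"
proof -
  have "det (transpose_mat A) \<noteq> 0" using det det_transpose[OF A] by simp
  then obtain y where y: "\<forall>b<N. (\<Sum>a<N. y a * transpose_mat A $$ (a, b)) = z b"
    using exists_row_solution[of "transpose_mat A" N z] A by auto
  have "(\<Sum>k<N. A $$ (i, k) * y k) = z i" if "i < N" for i
  proof -
    have "(\<Sum>k<N. A $$ (i, k) * y k) = (\<Sum>a<N. y a * transpose_mat A $$ (a, i))"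
      using A that by (intro sum.cong) auto
    then show ?thesis using y that by simp
  qed
  then show ?thesis by blast
qed

text \<open>Invariant of the induction along \<open>Theta_minus\<close>: \<open>A\<close> and \<open>B\<close> act on the first \<open>m + 1\<close>
  coordinates only, and their superdiagonals are the two right-hand sides. The weighted row sums
  give the first row of the inverse of \<open>A\<close>, from which the new superdiagonal entry of \<open>B\<close> is
  read off.\<close>

definition factorization ::
    "nat \<Rightarrow> (nat \<Rightarrow> nat \<Rightarrow> complex) \<Rightarrow> nat \<Rightarrow> complex mat \<Rightarrow> complex mat \<Rightarrow> bool" where
  "factorization n a m A B \<longleftrightarrow> A \<in> U_plus n \<and> B \<in> U_plus n \<and>
     (\<forall>r q. r \<le> n \<longrightarrow> m < q \<longrightarrow> q \<le> n \<longrightarrow> A $$ (r, q) = (if r = q then 1 else 0)) \<and>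
     (\<forall>r q. r \<le> n \<longrightarrow> m < q \<longrightarrow> q \<le> n \<longrightarrow> B $$ (r, q) = (if r = q then 1 else 0)) \<and>
     (\<forall>q\<le>m. (\<Sum>r\<le>m. (-1) ^ r / a m r * A $$ (r, q)) = (if q = 0 then 1 else 0)) \<and>
     (\<forall>i<m. A $$ (i, i + 1) = (\<Sum>t\<le>i. a (m - t) (i - t) / a (m - t) (i - t + 1))) \<and>
     (\<forall>j. 1 \<le> j \<longrightarrow> j \<le> m \<longrightarrow> B $$ (j - 1, j) = (\<Sum>b<j. a j (b + 1) / a (j - 1) b))"

text \<open>The bidiagonal factor \<open>P\<close> shifts \<open>e\<^sub>b\<close> to \<open>e\<^sub>b\<^sub>+\<^sub>1\<close> up to lower indices, so the columns of the
  new \<open>A\<close> are \<open>e\<^sub>0\<close> followed by those of \<open>P * A'\<close>. Only column \<open>m + 1\<close> then fails to match; it is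
  corrected by \<open>X\<close>, whose entries come from solving \<open>P z = a e\<^sub>m\<^sub>+\<^sub>1 \<plusminus> e\<^sub>0\<close> and \<open>A' y = z\<close>.\<close>

lemma factorization_step:
  assumes m: "m < n" and fac: "factorization n a m A' B'"
    and a0: "\<And>m. a m 0 = 1" and ane: "\<And>l. 1 \<le> l \<Longrightarrow> l \<le> Suc m \<Longrightarrow> a (Suc m) l \<noteq> 0"
  shows "\<exists>A B. factorization n a (Suc m) A B \<and>
    bidiag n (a (Suc m)) (Suc m) * (A' * partial_longest n m * B') = A * partial_longest n (Suc m) * B"
proof -
  let ?N = "n + 1" and ?M = "Suc m"
  define P where "P = bidiag n (a ?M) ?M"
  define d where "d r = (if r < ?M then a ?M r / a ?M (r + 1) else if r = ?M then a ?M ?M else 1)" for r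
  have A': "A' \<in> U_plus n" and B': "B' \<in> U_plus n"
    and A'id: "\<And>r q. r \<le> n \<Longrightarrow> m < q \<Longrightarrow> q \<le> n \<Longrightarrow> A' $$ (r, q) = (if r = q then 1 else 0)"
    and B'id: "\<And>r q. r \<le> n \<Longrightarrow> m < q \<Longrightarrow> q \<le> n \<Longrightarrow> B' $$ (r, q) = (if r = q then 1 else 0)"
    and rho': "\<And>q. q \<le> m \<Longrightarrow> (\<Sum>r\<le>m. (-1) ^ r / a m r * A' $$ (r, q)) = (if q = 0 then 1 else 0)"
    and A'sup: "\<And>i. i < m \<Longrightarrow>
      A' $$ (i, i + 1) = (\<Sum>t\<le>i. a (m - t) (i - t) / a (m - t) (i - t + 1))"
    and B'sup: "\<And>j. 1 \<le> j \<Longrightarrow> j \<le> m \<Longrightarrow> B' $$ (j - 1, j) = (\<Sum>b<j. a j (b + 1) / a (j - 1) b)"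
    using fac unfolding factorization_def by blast+
  note A'c = U_plusD(1)[OF A'] and A'1 = U_plusD(3)[OF A'] and A'0 = U_plusD(4)[OF A']
  note B'c = U_plusD(1)[OF B'] and B'1 = U_plusD(3)[OF B'] and B'0 = U_plusD(4)[OF B']
  have Pc: "P \<in> carrier_mat ?N ?N" unfolding P_def by (rule carrier_bidiag)
  have PA'c: "P * A' \<in> carrier_mat ?N ?N" by (rule mult_carrier_mat[OF Pc A'c])
  have PA': "(P * A') $$ (r, q) = d r * A' $$ (r, q) + (if 0 < r \<and> r \<le> ?M then A' $$ (r - 1, q) else 0)"
    if "r \<le> n" "q \<le> n" for r q
    unfolding P_def d_def by (rule bidiag_mult_index[OF A'c that])

  define A where "A = mat ?N ?N (\<lambda>(r, q). if q = 0 then (if r = 0 then 1 else 0)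
    else if q \<le> ?M then (P * A') $$ (r, q - 1) else if r = q then 1 else 0)"
  have A_idx: "A $$ (r, q) = (if q = 0 then (if r = 0 then 1 else 0)
    else if q \<le> ?M then (P * A') $$ (r, q - 1) else if r = q then 1 else 0)" if "r \<le> n" "q \<le> n" for r q
    using that by (simp add: A_def)
  have Ac: "A \<in> carrier_mat ?N ?N" by (simp add: A_def)
  have A: "A \<in> U_plus n"
  proof (rule U_plusI[OF Ac])
    fix i assume i: "i \<le> n"
    show "A $$ (i, i) = 1"
      using i A'1[of "i - 1"] A'0[of i "i - 1"] by (auto simp: A_idx PA')
  next
    fix i j assume ij: "i \<le> n" "j < i"
    show "A $$ (i, j) = 0"
      using ij A'0[of i "j - 1"] A'0[of "i - 1" "j - 1"] by (auto simp: A_idx PA')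
  qed
  \<comment> \<open>The weights \<open>(-1) ^ r / a ?M r\<close> form a row vector that
    \<open>P\<close> annihilates in the columns up to \<open>m\<close>, since \<open>d r\<close> is
    a ratio of consecutive values of \<open>a ?M\<close>. Columns 1 to \<open>?M\<close> of
    \<open>A\<close> are \<open>P\<close> applied to columns of \<open>A'\<close> supported in the
    rows up to \<open>m\<close>, so pairing with them gives 0.\<close>
  have rho: "(\<Sum>r\<le>?M. (-1) ^ r / a ?M r * A $$ (r, q)) = (if q = 0 then 1 else 0)" if q: "q \<le> ?M" for q
  proof (cases "q = 0")
    case True
    have "(\<Sum>r\<le>?M. (-1) ^ r / a ?M r * A $$ (r, q)) = (\<Sum>r\<le>?M. if r = 0 then 1 else 0)"
      using True m a0 by (intro sum.cong) (auto simp: A_idx)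
    then show ?thesis using True by simp
  next
    case False
    let ?r = "\<lambda>r. (-1) ^ r / a ?M r"
    have top: "A' $$ (?M, q - 1) = 0" using False q m by (intro A'0) auto
    have "(\<Sum>r\<le>?M. ?r r * A $$ (r, q)) = (\<Sum>r\<le>?M. ?r r * d r * A' $$ (r, q - 1)) +
        (\<Sum>r\<le>?M. ?r r * (if 0 < r \<and> r \<le> ?M then A' $$ (r - 1, q - 1) else 0))"
      unfolding sum.distrib[symmetric] using False q m
      by (intro sum.cong) (auto simp: A_idx PA' algebra_simps)
    also have "(\<Sum>r\<le>?M. ?r r * d r * A' $$ (r, q - 1)) = (\<Sum>r\<le>m. ?r r * d r * A' $$ (r, q - 1))"
      using top by simp
    also have "(\<Sum>r\<le>?M. ?r r * (if 0 < r \<and> r \<le> ?M then A' $$ (r - 1, q - 1) else 0)) =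
        (\<Sum>r\<le>m. ?r (Suc r) * A' $$ (r, q - 1))"
      unfolding sum.atMost_Suc_shift by simp
    also have "(\<Sum>r\<le>m. ?r r * d r * A' $$ (r, q - 1)) + (\<Sum>r\<le>m. ?r (Suc r) * A' $$ (r, q - 1)) =
        (\<Sum>r\<le>m. (?r r * d r + ?r (Suc r)) * A' $$ (r, q - 1))"
      by (simp only: sum.distrib distrib_right)
    also have "\<dots> = 0"
    proof (rule sum.neutral, clarify)
      fix r assume "r \<le> m"
      then have "a ?M r \<noteq> 0" "a ?M (Suc r) \<noteq> 0" using ane[of r] ane[of "Suc r"] a0 by (cases "r = 0"; simp)+
      then have "?r r * d r + ?r (Suc r) = 0" using \<open>r \<le> m\<close> by (simp add: d_def)
      then show "(?r r * d r + ?r (Suc r)) * A' $$ (r, q - 1) = 0" by simp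
    qed
    finally show ?thesis using False by simp
  qed
  have Asup: "A $$ (i, i + 1) = (\<Sum>t\<le>i. a (?M - t) (i - t) / a (?M - t) (i - t + 1))" if i: "i < ?M" for i
  proof (cases i)
    case 0
    then show ?thesis using m A'1[of 0] by (simp add: A_idx PA' d_def)
  next
    case (Suc k)
    have "A $$ (i, i + 1) = d i + A' $$ (k, k + 1)"
      using i Suc m A'1[of i] by (simp add: A_idx PA')
    also have "\<dots> = a ?M i / a ?M (i + 1) + (\<Sum>t\<le>k. a (m - t) (k - t) / a (m - t) (k - t + 1))"
      using i Suc A'sup[of k] by (simp add: d_def)
    finally show ?thesis unfolding Suc sum.atMost_Suc_shift by simp
  qed

  \<comment> \<open>The signs make \<open>d r * z r\<close> cancel \<open>z (r - 1)\<close> for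
    \<open>0 < r \<le> m\<close>; what survives in \<open>P z\<close> is \<open>(-1) ^ m\<close> in
    row 0 and \<open>a ?M ?M\<close> in row \<open>?M\<close>.\<close>
  define z where "z b = (if b \<le> m then (-1) ^ (m - b) * a ?M (b + 1) else 0)" for b
  obtain y where y: "\<And>i. i \<le> n \<Longrightarrow> (\<Sum>k<?N. A' $$ (i, k) * y k) = z i"
    using exists_column_solution[OF A'c, of z] U_plusD(2)[OF A']
    by (metis less_Suc_eq_le Suc_eq_plus1 zero_neq_one)
  \<comment> \<open>Beyond \<open>m\<close> the matrix \<open>A'\<close> acts as the identity, so
    \<open>y\<close> vanishes there together with \<open>z\<close>.\<close>
  have y0: "y i = 0" if "m < i" "i \<le> n" for i
  proof -
    have "z i = (\<Sum>k<?N. A' $$ (i, k) * y k)" using y that by simp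
    also have "\<dots> = (\<Sum>k<?N. if k = i then y i else 0)"
    proof (rule sum.cong)
      fix k assume "k \<in> {..<?N}"
      then show "A' $$ (i, k) * y k = (if k = i then y i else 0)"
        using that A'id[of i k] A'0[of i k] by (cases "k < i") auto
    qed simp
    also have "\<dots> = y i" using that by (subst sum.delta) auto
    finally show ?thesis using that by (simp add: z_def)
  qed
  have y': "(\<Sum>k\<le>m. A' $$ (i, k) * y k) = z i" if "i \<le> n" for i
  proof -
    have "(\<Sum>k<?N. A' $$ (i, k) * y k) = (\<Sum>k\<le>m. A' $$ (i, k) * y k)"
      using m y0 by (intro sum.mono_neutral_right) auto
    then show ?thesis using y[OF that] by simp
  qed
  \<comment> \<open>Reversal and sign undo \<open>?W\<close>: for \<open>b \<le> m\<close>, column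
    \<open>b\<close> of \<open>A * ?W\<close> is \<open>(-1) ^ b\<close> times column
    \<open>m - b\<close> of \<open>P * A'\<close>.\<close>
  define x where "x b = (-1) ^ b * y (m - b)" for b
  \<comment> \<open>Up to sign \<open>x m\<close> is \<open>y 0\<close>, the first row of the
    inverse of \<open>A'\<close> applied to \<open>z\<close>; that row is known from
    \<open>rho'\<close>.\<close>
  have xm: "x m = (\<Sum>b<?M. a ?M (b + 1) / a m b)"
  proof -
    have "(\<Sum>r\<le>m. (-1) ^ r / a m r * z r) = (\<Sum>r\<le>m. \<Sum>k\<le>m. (-1) ^ r / a m r * A' $$ (r, k) * y k)"
      using m by (intro sum.cong) (simp_all add: y'[symmetric] sum_distrib_left mult.assoc)
    also have "\<dots> = (\<Sum>k\<le>m. (\<Sum>r\<le>m. (-1) ^ r / a m r * A' $$ (r, k)) * y k)"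
      by (subst sum.swap) (simp add: sum_distrib_right)
    also have "\<dots> = (\<Sum>k\<le>m. if k = 0 then y 0 else 0)" by (intro sum.cong refl) (simp only: rho' atMost_iff, simp)
    also have "\<dots> = y 0" by simp
    finally have "x m = (-1) ^ m * (\<Sum>r\<le>m. (-1) ^ r / a m r * z r)"
      by (simp only: x_def diff_self_eq_0)
    also have "\<dots> = (\<Sum>r\<le>m. (-1) ^ m * ((-1) ^ r / a m r * z r))" by (rule sum_distrib_left)
    also have "\<dots> = (\<Sum>r\<le>m. a ?M (r + 1) / a m r)"
    proof (rule sum.cong)
      fix r assume "r \<in> {..m}"
      then have "(-1 :: complex) ^ m * ((-1) ^ r * (-1) ^ (m - r)) = 1"
        by (simp flip: power_add power_mult_distrib)
      then show "(-1) ^ m * ((-1) ^ r / a m r * z r) = a ?M (r + 1) / a m r"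
        using \<open>r \<in> {..m}\<close> by (simp add: z_def field_simps)
    qed simp
    finally show ?thesis by (simp add: lessThan_Suc_atMost)
  qed
  define X where "X = mat ?N ?N (\<lambda>(r, q). if r = q then 1 else if q = ?M \<and> r < ?M then x r else 0)"
  have Xc: "X \<in> carrier_mat ?N ?N" by (simp add: X_def)
  define B where "B = X * B'"
  have Bc: "B \<in> carrier_mat ?N ?N" unfolding B_def by (rule mult_carrier_mat[OF Xc B'c])
  have B_idx: "B $$ (r, q) = B' $$ (r, q) + (if r < ?M \<and> q = ?M then x r else 0)"
    if "r \<le> n" "q \<le> n" for r q
  proof -
    have "B $$ (r, q) = (\<Sum>k<?N. X $$ (r, k) * B' $$ (k, q))"
      unfolding B_def using that by (intro mat_mult_index[OF Xc B'c]) auto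
    also have "\<dots> = (\<Sum>k<?N. (if k = r then B' $$ (r, q) else 0) +
        (if k = ?M then (if r < ?M then x r * B' $$ (?M, q) else 0) else 0))"
      using that by (intro sum.cong) (auto simp: X_def)
    also have "\<dots> = B' $$ (r, q) + (if r < ?M then x r * B' $$ (?M, q) else 0)"
      unfolding sum.distrib using that m by (subst (1 2) sum.delta) auto
    \<comment> \<open>Row \<open>?M\<close> of \<open>B'\<close> is a unit vector, so passing from
      \<open>B'\<close> to \<open>B\<close> changes column \<open>?M\<close> only.\<close>
    also have "B' $$ (?M, q) = (if q = ?M then 1 else 0)"
      using that m B'id[of ?M q] B'0[of ?M q] by (cases "q < ?M") auto
    finally show ?thesis by auto
  qed
  have B: "B \<in> U_plus n"
    using B'1 B'0 by (intro U_plusI[OF Bc]) (auto simp: B_idx)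
  have Bsup: "B $$ (j - 1, j) = (\<Sum>b<j. a j (b + 1) / a (j - 1) b)" if "1 \<le> j" "j \<le> ?M" for j
  proof (cases "j = ?M")
    case True
    then show ?thesis using m B'id[of m ?M] xm by (simp add: B_idx)
  next
    case False
    then show ?thesis using that m B'sup[of j] by (simp add: B_idx)
  qed
  have fac': "factorization n a ?M A B"
    unfolding factorization_def
  proof (intro conjI allI impI)
    fix r q assume "r \<le> n" "?M < q" "q \<le> n"
    then show "A $$ (r, q) = (if r = q then 1 else 0)" "B $$ (r, q) = (if r = q then 1 else 0)"
      using B'id[of r q] by (auto simp: A_idx B_idx)
  qed (use A B rho Asup Bsup in auto)

  let ?W' = "partial_longest n m" and ?W = "partial_longest n ?M"
  note W'c = carrier_partial_longest[of n m] and Wc = carrier_partial_longest[of n ?M]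
  have AWc: "A * ?W \<in> carrier_mat ?N ?N" by (rule mult_carrier_mat[OF Ac Wc])
  have "P * A' * ?W' = A * ?W * X"
  proof (rule eq_matI)
    fix r q assume "r < dim_row (A * ?W * X)" "q < dim_col (A * ?W * X)"
    then have rq: "r \<le> n" "q \<le> n" using Ac Xc by auto
    have lhs: "(P * A' * ?W') $$ (r, q) =
        (if q \<le> m then (-1) ^ q * (P * A') $$ (r, m - q) else (P * A') $$ (r, q))"
      using m rq by (intro mult_partial_longest_index[OF PA'c]) auto
    have AW: "(A * ?W) $$ (r, q) = (if q \<le> ?M then (-1) ^ q * A $$ (r, ?M - q) else A $$ (r, q))"
      if "q \<le> n" for q
      using m rq that by (intro mult_partial_longest_index[OF Ac]) auto
    have "(A * ?W * X) $$ (r, q) = (\<Sum>k<?N. (A * ?W) $$ (r, k) * X $$ (k, q))"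
      using rq by (intro mat_mult_index[OF AWc Xc]) auto
    also have "\<dots> = (\<Sum>k<?N. (if k = q then (A * ?W) $$ (r, q) else 0) +
        (if k < ?M \<and> q = ?M then (A * ?W) $$ (r, k) * x k else 0))"
      using rq by (intro sum.cong) (auto simp: X_def)
    also have "\<dots> = (A * ?W) $$ (r, q) + (\<Sum>k<?N. if k < ?M \<and> q = ?M then (A * ?W) $$ (r, k) * x k else 0)"
      unfolding sum.distrib using rq by (subst sum.delta) auto
    also have "(\<Sum>k<?N. if k < ?M \<and> q = ?M then (A * ?W) $$ (r, k) * x k else 0) =
        (if q = ?M then (\<Sum>k\<le>m. (A * ?W) $$ (r, k) * x k) else 0)"
    proof (cases "q = ?M")
      case True
      have "(\<Sum>k<?N. if k < ?M \<and> q = ?M then (A * ?W) $$ (r, k) * x k else 0) =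
          (\<Sum>k\<le>m. if k < ?M \<and> q = ?M then (A * ?W) $$ (r, k) * x k else 0)"
        using m by (intro sum.mono_neutral_right) auto
      also have "\<dots> = (\<Sum>k\<le>m. (A * ?W) $$ (r, k) * x k)" using True by (intro sum.cong) auto
      finally show ?thesis using True by simp
    qed simp
    finally have rhs: "(A * ?W * X) $$ (r, q) =
        (A * ?W) $$ (r, q) + (if q = ?M then (\<Sum>k\<le>m. (A * ?W) $$ (r, k) * x k) else 0)" .
    consider "q \<le> m" | "q > ?M" | "q = ?M" by linarith
    then show "(P * A' * ?W') $$ (r, q) = (A * ?W * X) $$ (r, q)"
    proof cases
      case 1
      then show ?thesis unfolding lhs rhs using rq m by (auto simp: AW A_idx Suc_diff_le)
    next
      case 2
      then show ?thesis unfolding lhs rhs using rq m A'id[of r q] A'id[of "r - 1" q]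
        by (auto simp: AW A_idx PA' d_def)
    next
      case 3
      \<comment> \<open>On the left, column \<open>?M\<close> is \<open>a ?M ?M\<close> times a unit
        vector; on the right, \<open>A * ?W\<close> contributes \<open>(-1) ^ ?M\<close> in row 0.
        The combination with coefficients \<open>x\<close> equals \<open>P z\<close>, which supplies
        the former and cancels the latter.\<close>
      have "(\<Sum>k\<le>m. (A * ?W) $$ (r, k) * x k) = (\<Sum>k\<le>m. (P * A') $$ (r, m - k) * y (m - k))"
      proof (rule sum.cong)
        fix k assume "k \<in> {..m}"
        moreover have "(-1 :: complex) ^ k * (-1) ^ k = 1" by (simp flip: power_mult_distrib)
        ultimately show "(A * ?W) $$ (r, k) * x k = (P * A') $$ (r, m - k) * y (m - k)"
          using rq m by (simp add: AW A_idx x_def Suc_diff_le)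
      qed simp
      also have "\<dots> = (\<Sum>s\<le>m. (P * A') $$ (r, s) * y s)"
        by (rule sum.nat_diff_reindex[of "\<lambda>s. (P * A') $$ (r, s) * y s" "Suc m", unfolded lessThan_Suc_atMost, simplified])
      also have "\<dots> = d r * (\<Sum>s\<le>m. A' $$ (r, s) * y s) +
          (if 0 < r \<and> r \<le> ?M then (\<Sum>s\<le>m. A' $$ (r - 1, s) * y s) else 0)"
        using rq m by (simp add: PA' sum.distrib sum_distrib_left algebra_simps)
      also have "\<dots> = d r * z r + (if 0 < r \<and> r \<le> ?M then z (r - 1) else 0)"
        using rq by (simp add: y')
      finally have sum: "(\<Sum>k\<le>m. (A * ?W) $$ (r, k) * x k) =
          d r * z r + (if 0 < r \<and> r \<le> ?M then z (r - 1) else 0)" .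
      have PAq: "(P * A') $$ (r, q) = (if r = ?M then a ?M ?M else 0)"
        using rq 3 A'id[of r q] A'id[of "r - 1" q] by (auto simp: PA' d_def)
      have AWq: "(A * ?W) $$ (r, q) = (if r = 0 then (-1) ^ ?M else 0)"
        using rq 3 by (simp add: AW A_idx)
      consider "r = 0" | "0 < r" "r \<le> m" | "r = ?M" | "r > ?M" by linarith
      then show ?thesis unfolding lhs rhs sum PAq AWq
      proof cases
        case 1
        then show "(if q \<le> m then (-1) ^ q * (P * A') $$ (r, m - q) else if r = ?M then a ?M ?M else 0) =
          (if r = 0 then (-1) ^ ?M else 0) +
          (if q = ?M then d r * z r + (if 0 < r \<and> r \<le> ?M then z (r - 1) else 0) else 0)"
          using 3 a0 ane[of 1] by (simp add: d_def z_def)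
      next
        case 2
        then have "m - (r - 1) = Suc (m - r)" by simp
        then show "(if q \<le> m then (-1) ^ q * (P * A') $$ (r, m - q) else if r = ?M then a ?M ?M else 0) =
          (if r = 0 then (-1) ^ ?M else 0) +
          (if q = ?M then d r * z r + (if 0 < r \<and> r \<le> ?M then z (r - 1) else 0) else 0)"
          using 3 2 ane[of "Suc r"] by (simp add: d_def z_def)
      qed (use 3 in \<open>auto simp: d_def z_def\<close>)
    qed
  qed (use Pc Xc W'c Ac in auto)
  then have "P * A' * ?W' * B' = A * ?W * X * B'" by simp
  also have "\<dots> = A * ?W * B" unfolding B_def by (rule assoc_mult_mat[OF AWc Xc B'c])
  also have "P * A' * ?W' * B' = P * (A' * ?W' * B')"
    by (simp only: assoc_mult_mat[OF Pc A'c W'c] assoc_mult_mat[OF Pc mult_carrier_mat[OF A'c W'c] B'c])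
  finally show ?thesis using fac' unfolding P_def by blast
qed

lemma exists_factorization:
  assumes T0: "T 0 = 1\<^sub>m (n + 1)"
    and T: "\<And>m. m < n \<Longrightarrow> T (Suc m) = bidiag n (a (Suc m)) (Suc m) * T m"
    and a0: "\<And>m. a m 0 = 1" and ane: "\<And>m l. 1 \<le> l \<Longrightarrow> l \<le> m \<Longrightarrow> m \<le> n \<Longrightarrow> a m l \<noteq> 0"
    and m: "m \<le> n"
  shows "\<exists>A B. factorization n a m A B \<and> T m = A * partial_longest n m * B"
  using m
proof (induction m)
  case 0
  have "partial_longest n 0 = 1\<^sub>m (n + 1)" by (auto simp: partial_longest_def intro!: eq_matI)
  moreover have "factorization n a 0 (1\<^sub>m (n + 1)) (1\<^sub>m (n + 1))"
    unfolding factorization_def using a0 by (auto intro!: U_plusI)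
  ultimately show ?case using T0 by (intro exI[of _ "1\<^sub>m (n + 1)"]) simp
next
  case (Suc m)
  then obtain A' B' where "factorization n a m A' B'" "T m = A' * partial_longest n m * B'" by auto
  then show ?case using factorization_step[of m n a A' B'] a0 ane Suc.prems T[of m] by auto
qed

section \<open>The two minors\<close>

lemma Theta_minus_factorization:
  assumes c: "\<And>k l. \<lbrakk>1 \<le> k; k \<le> n; 1 \<le> l; l \<le> n - k + 1\<rbrakk> \<Longrightarrow> c k l \<noteq> 0"
  shows "\<exists>A B. factorization n (\<lambda>m l. if l = 0 then 1 else c (n + 1 - m) l) n A B \<and>
    Theta_minus n c = A * w_bar n (longest n) * B"
proof -
  \<comment> \<open>Blocks are renumbered by their length: the one with \<open>m\<close> letters is
    block \<open>n + 1 - m\<close>, so \<open>T m\<close> below is the product of the last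
    \<open>m\<close> blocks. The value 1 at \<open>l = 0\<close> is the convention of
    \<open>bidiag\<close>.\<close>
  define a where "a = (\<lambda>m l. if l = 0 then 1 else c (n + 1 - m) l)"
  let ?f = "\<lambda>(k, l). y_bold n l (c k l)"
  define T where "T m = mat_prod n (map ?f (concat (map (\<lambda>k. map (Pair k) [1..<n + 2 - k]) [n + 1 - m..<n + 1])))" for m
  have a0: "a m 0 = 1" for m by (simp add: a_def)
  have ane: "a m l \<noteq> 0" if "1 \<le> l" "l \<le> m" "m \<le> n" for m l
    using c[of "n + 1 - m" l] that by (auto simp: a_def)
  have T0: "T 0 = 1\<^sub>m (n + 1)" by (simp add: T_def mat_prod_Nil)
  have TSuc: "T (Suc m) = bidiag n (a (Suc m)) (Suc m) * T m" if m: "m < n" for m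
  proof -
    have "[n + 1 - Suc m..<n + 1] = (n - m) # [n + 1 - m..<n + 1]"
      using m upt_conv_Cons[of "n - m" "n + 1"] by (simp add: Suc_diff_le del: upt_Suc)
    then have "T (Suc m) = mat_prod n (map ?f (map (Pair (n - m)) [1..<n + 2 - (n - m)]) @
        map ?f (concat (map (\<lambda>k. map (Pair k) [1..<n + 2 - k]) [n + 1 - m..<n + 1])))"
      unfolding T_def by (simp only: list.map concat.simps map_append)
    also have "\<dots> = mat_prod n (map ?f (map (Pair (n - m)) [1..<n + 2 - (n - m)])) * T m"
      unfolding T_def using carrier_y_bold by (intro mat_prod_append) auto
    also have "map ?f (map (Pair (n - m)) [1..<n + 2 - (n - m)]) =
        map (\<lambda>l. y_bold n l (a (Suc m) l)) [1..<Suc m + 1]"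
      using m by (auto simp: a_def intro!: map_cong)
    also have "mat_prod n (map (\<lambda>l. y_bold n l (a (Suc m) l)) [1..<Suc m + 1]) =
        bidiag n (a (Suc m)) (Suc m)"
      using m a0 ane by (intro mat_prod_y_bold_eq_bidiag) auto
    finally show ?thesis .
  qed
  have "\<exists>A B. factorization n a n A B \<and> T n = A * partial_longest n n * B"
    by (rule exists_factorization[of T, OF T0 TSuc a0 ane order_refl])
  moreover have "T n = Theta_minus n c" by (simp add: T_def Theta_minus_def index_pairs_def)
  moreover have "partial_longest n n = w_bar n (longest n)"
    by (auto simp: partial_longest_def w_bar_longest intro!: eq_matI)
  ultimately show ?thesis unfolding a_def by simp
qed

lemma mult_s_bar_index:
  assumes j: "j \<in> {1..n}" and M: "M \<in> carrier_mat (n + 1) (n + 1)" and rb: "r \<le> n" "b \<le> n"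
  shows "(M * s_bar n j) $$ (r, b) =
    (if b = j - 1 then M $$ (r, j) else if b = j then - M $$ (r, j - 1) else M $$ (r, b))"
proof -
  have "(M * s_bar n j) $$ (r, b) = (\<Sum>k<n + 1. M $$ (r, k) * s_bar n j $$ (k, b))"
    using rb by (intro mat_mult_index[OF M carrier_s_bar]) auto
  also have "\<dots> = (\<Sum>k<n + 1. if k = (if b = j - 1 then j else if b = j then j - 1 else b)
      then (if b = j - 1 then M $$ (r, j) else if b = j then - M $$ (r, j - 1) else M $$ (r, b)) else 0)"
    using j rb by (intro sum.cong) (auto simp: s_bar_eq)
  also have "\<dots> = (if b = j - 1 then M $$ (r, j) else if b = j then - M $$ (r, j - 1) else M $$ (r, b))"
    using j rb by (subst sum.delta) auto
  finally show ?thesis .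
qed

text \<open>Among the first \<open>j\<close> columns only the last is replaced, by column
  \<open>j\<close> of \<open>B\<close>. The block stays triangular, and its last diagonal entry is
  the superdiagonal one of \<open>B\<close>.\<close>

lemma det_leading_block_mult_s_bar:
  assumes B: "B \<in> U_plus n" and j: "j \<in> {1..n}"
  shows "det (leading_block j (B * s_bar n j)) = B $$ (j - 1, j)"
proof -
  note idx = mult_s_bar_index[OF j U_plusD(1)[OF B]]
  let ?C = "leading_block j (B * s_bar n j)"
  have C: "?C $$ (r, b) = (if b = j - 1 then B $$ (r, j) else B $$ (r, b))" if "r < j" "b < j" for r b
    using that j idx[of r b] by (simp add: leading_block_index)
  have "upper_triangular ?C"
  proof (rule upper_triangularI)
    fix b r assume "b < r" "r < dim_row ?C"
    then show "?C $$ (r, b) = 0" using C[of r b] U_plusD(4)[OF B, of r b] j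
      by (auto simp: leading_block_def)
  qed
  then have "det ?C = prod_list (diag_mat ?C)" by (rule det_upper_triangular[OF _ carrier_leading_block])
  also have "\<dots> = (\<Prod>i\<in>{0..<j}. ?C $$ (i, i))"
    unfolding prod_list_diag_prod by (simp add: leading_block_def)
  also have "\<dots> = (\<Prod>i\<in>{0..<j}. if i = j - 1 then B $$ (j - 1, j) else 1)"
    using j U_plusD(3)[OF B] by (intro prod.cong) (auto simp: C)
  also have "\<dots> = B $$ (j - 1, j)" using j by (subst prod.delta) auto
  finally show ?thesis .
qed

text \<open>The analogue for rows; here \<open>s_bar\<close> negates the row that it brings into the
  block.\<close>

lemma det_leading_block_s_bar_mult:
  assumes L: "L \<in> U_minus n" and j: "j \<in> {1..n}"
  shows "det (leading_block j (s_bar n j * L)) = - L $$ (j, j - 1)"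
proof -
  note idx = s_bar_mult_index[OF j U_minusD(1)[OF L]]
  let ?C = "leading_block j (s_bar n j * L)"
  have C: "?C $$ (r, b) = (if r = j - 1 then - L $$ (j, b) else L $$ (r, b))" if "r < j" "b < j" for r b
    using that j idx[of r b] by (simp add: leading_block_index)
  have "det ?C = prod_list (diag_mat ?C)"
    using C U_minusD(4)[OF L] j by (intro det_lower_triangular[OF _ carrier_leading_block]) auto
  also have "\<dots> = (\<Prod>i\<in>{0..<j}. ?C $$ (i, i))"
    unfolding prod_list_diag_prod by (simp add: leading_block_def)
  also have "\<dots> = (\<Prod>i\<in>{0..<j}. if i = j - 1 then - L $$ (j, j - 1) else 1)"
    using j U_minusD(3)[OF L] by (intro prod.cong) (auto simp: C)
  also have "\<dots> = - L $$ (j, j - 1)" using j by (subst prod.delta) auto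
  finally show ?thesis .
qed

text \<open>Reversing both indices turns upper into lower triangular. Next to the diagonal the
  factor \<open>(-1) ^ (i + j)\<close> is -1; it will cancel the sign that \<open>s_bar\<close>
  produces in the second minor.\<close>

lemma conjugate_longest:
  assumes A: "A \<in> U_plus n"
  defines "L \<equiv> mat (n + 1) (n + 1) (\<lambda>(i, j). (-1) ^ (i + j) * A $$ (n - i, n - j))"
  shows "L \<in> U_minus n" "A * w_bar n (longest n) = w_bar n (longest n) * L"
proof -
  let ?N = "n + 1" and ?W = "w_bar n (longest n)"
  note Ac = U_plusD(1)[OF A]
  have Lc: "L \<in> carrier_mat ?N ?N" by (simp add: L_def)
  show "L \<in> U_minus n"
  proof (rule U_minusI[OF Lc])
    fix i assume "i \<le> n"
    moreover have "(-1 :: complex) ^ (i + i) = 1" by (simp flip: mult_2)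
    ultimately show "L $$ (i, i) = 1" using U_plusD(3)[OF A, of "n - i"] by (simp add: L_def)
  next
    fix i j assume "j \<le> n" "i < j"
    then show "L $$ (i, j) = 0" using U_plusD(4)[OF A, of "n - i" "n - j"] by (simp add: L_def)
  qed
  have Wc: "?W \<in> carrier_mat ?N ?N" by (simp add: w_bar_longest)
  show "A * ?W = ?W * L"
  proof (rule eq_matI)
    fix i j assume "i < dim_row (?W * L)" "j < dim_col (?W * L)"
    then have ij: "i \<le> n" "j \<le> n" using Wc Lc by auto
    have "(A * ?W) $$ (i, j) = (\<Sum>k<?N. A $$ (i, k) * ?W $$ (k, j))"
      using ij by (intro mat_mult_index[OF Ac Wc]) auto
    also have "\<dots> = (\<Sum>k<?N. if k = n - j then (-1) ^ j * A $$ (i, n - j) else 0)"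
      using ij by (intro sum.cong) (auto simp: w_bar_longest)
    also have "\<dots> = (-1) ^ j * A $$ (i, n - j)" using ij by simp
    finally have lhs: "(A * ?W) $$ (i, j) = (-1) ^ j * A $$ (i, n - j)" .
    have "(?W * L) $$ (i, j) = (\<Sum>k<?N. ?W $$ (i, k) * L $$ (k, j))"
      using ij by (intro mat_mult_index[OF Wc Lc]) auto
    also have "\<dots> = (\<Sum>k<?N. if k = n - i then (-1) ^ (n - i) * L $$ (n - i, j) else 0)"
      using ij by (intro sum.cong) (auto simp: w_bar_longest)
    also have "\<dots> = (-1) ^ (n - i) * L $$ (n - i, j)" by simp
    also have "\<dots> = ((-1) ^ (n - i) * (-1) ^ (n - i)) * (-1) ^ j * A $$ (i, n - j)"
      using ij by (simp add: L_def power_add)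
    also have "(-1 :: complex) ^ (n - i) * (-1) ^ (n - i) = 1" by (simp flip: power_mult_distrib)
    finally show "(A * ?W) $$ (i, j) = (?W * L) $$ (i, j)" using lhs by simp
  qed (use Ac Lc Wc in auto)
qed

(* The second identity is stated at the dual node n - j + 1 of the Dynkin diagram. With j itself
   on the left-hand side, as in the source, it fails: for n = 2, j = 1 the minor is the matrix
   entry 1 / c 2 1 + c 1 1 / c 1 2, whereas the right-hand side is 1 / c 1 1. *)
theorem theorem4p4:
  fixes n j :: nat and c :: "nat \<Rightarrow> nat \<Rightarrow> complex"
  assumes "\<And>k l. \<lbrakk>1 \<le> k; k \<le> n; 1 \<le> l; l \<le> n - k + 1\<rbrakk> \<Longrightarrow> c k l \<noteq> 0"
    and "j \<in> {1..n}"
  shows "gen_minor n (fund_weight j) (longest n) (s_refl j) (Theta_minus n c)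
           = c (n - j + 1) 1 + (\<Sum>k = 2..j. c (n - j + 1) k / c (n - j + 2) (k - 1)) \<and>
         gen_minor n (fund_weight (n - j + 1)) (longest n \<circ> s_refl (n - j + 1)) id (Theta_minus n c)
           = 1 / c j 1 + (\<Sum>k = 1..j - 1. c (j - k) k / c (j - k) (k + 1))"
proof -
  interpret G: group "SL n" by (rule group_SL)
  let ?N = "n + 1" and ?W = "w_bar n (longest n)" and ?\<Theta> = "Theta_minus n c"
  define a where "a = (\<lambda>m l. if l = 0 then 1 else c (n + 1 - m) l)"
  have j: "1 \<le> j" "j \<le> n" using assms(2) by auto
  obtain A B where fac: "factorization n a n A B" and Theta: "?\<Theta> = A * ?W * B"
    using Theta_minus_factorization[of n c] assms(1) unfolding a_def by blast
  have A: "A \<in> U_plus n" and B: "B \<in> U_plus n" using fac by (auto simp: factorization_def)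
  have Asup: "A $$ (j - 1, j) = (\<Sum>t\<le>j - 1. a (n - t) (j - 1 - t) / a (n - t) (j - 1 - t + 1))"
  proof -
    have "\<forall>i<n. A $$ (i, i + 1) = (\<Sum>t\<le>i. a (n - t) (i - t) / a (n - t) (i - t + 1))"
      using fac unfolding factorization_def by blast
    then show ?thesis using j by (auto dest: spec[of _ "j - 1"])
  qed
  have Bsup: "B $$ (j - 1, j) = (\<Sum>b<j. a j (b + 1) / a (j - 1) b)"
    using fac j unfolding factorization_def by blast
  define L where "L = mat ?N ?N (\<lambda>(i, j). (-1) ^ (i + j) * A $$ (n - i, n - j))"
  have L: "L \<in> U_minus n" and AW: "A * ?W = ?W * L"
    unfolding L_def by (rule conjugate_longest[OF A])+
  have SL: "L \<in> carrier (SL n)" "B \<in> carrier (SL n)"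
    using L B by (auto simp: U_minus_def U_plus_def)
  have s: "s_bar n i \<in> carrier (SL n)" if "i \<in> {1..n}" for i
    using that carrier_s_bar det_s_bar by (simp add: carrier_SL)
  have longest: "longest n permutes {1..n + 1}"
    unfolding longest_eq_reversal by (rule reversal_permutes)
  have W: "?W \<in> carrier (SL n)" by (rule w_bar_SL[OF longest])
  note mult = mult_SL[of n, symmetric]
  have Theta': "?\<Theta> = ?W \<otimes>\<^bsub>SL n\<^esub> (L \<otimes>\<^bsub>SL n\<^esub> B)"
    unfolding Theta AW unfolding mult using W SL by (simp add: G.m_assoc)

  \<comment> \<open>\<open>?W\<close> cancels, and the lower unitriangular \<open>L\<close> left in
    front does not change leading minors.\<close>
  have "inv\<^bsub>SL n\<^esub> ?W * ?\<Theta> * w_bar n (s_refl j) = L * (B * s_bar n j)"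
    unfolding w_bar_s_refl[OF assms(2)] mult Theta'
    using W SL s[OF assms(2)] by (simp add: G.m_assoc[symmetric])
  moreover have "L * (B * s_bar n j) \<in> carrier (SL n)"
    unfolding mult using SL s[OF assms(2)] by simp
  ultimately have "gen_minor n (fund_weight j) (longest n) (s_refl j) ?\<Theta> =
      det (leading_block j (L * (B * s_bar n j)))"
    using j by (simp add: gen_minor_def principal_minor_fund_weight)
  also have "\<dots> = det (leading_block j L) * det (leading_block j (B * s_bar n j))"
    using U_minusD(4)[OF L] j
    by (intro det_leading_block_mult[OF U_minusD(1)[OF L] mult_carrier_mat[OF U_plusD(1)[OF B] carrier_s_bar]]) auto
  also have "\<dots> = B $$ (j - 1, j)"
    using det_leading_block_U_minus[OF L] det_leading_block_mult_s_bar[OF B assms(2)] j by simp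
  \<comment> \<open>The summand \<open>b = 0\<close> has denominator \<open>a (j - 1) 0\<close>,
    which is 1; it is the isolated first term of the formula.\<close>
  also have "\<dots> = (\<Sum>b\<in>insert 0 {1..<j}. a j (b + 1) / a (j - 1) b)"
    unfolding Bsup using j by (intro sum.cong) auto
  also have "\<dots> = c (n - j + 1) 1 + (\<Sum>b = 1..<j. a j (b + 1) / a (j - 1) b)"
    using j by (simp add: a_def Suc_diff_le)
  also have "(\<Sum>b = 1..<j. a j (b + 1) / a (j - 1) b) =
      (\<Sum>k = 2..j. c (n - j + 1) k / c (n - j + 2) (k - 1))"
  proof (rule sum.reindex_bij_witness[of _ "\<lambda>k. k - 1" "\<lambda>b. b + 1"])
    fix b assume b: "b \<in> {1..<j}"
    have "n + 1 - j = n - j + 1" "n + 1 - (j - 1) = n - j + 2" using j by auto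
    then show "c (n - j + 1) (b + 1) / c (n - j + 2) (b + 1 - 1) = a j (b + 1) / a (j - 1) b"
      using b by (simp add: a_def)
  qed auto
  finally have first: "gen_minor n (fund_weight j) (longest n) (s_refl j) ?\<Theta>
      = c (n - j + 1) 1 + (\<Sum>k = 2..j. c (n - j + 1) k / c (n - j + 2) (k - 1))" .

  \<comment> \<open>The dual node: conjugation by the longest element carries the entry of
    \<open>A\<close> at \<open>(j - 1, j)\<close>, up to sign, to that of \<open>L\<close> at
    \<open>(i, i - 1)\<close>.\<close>
  define i where "i = n - j + 1"
  have i: "i \<in> {1..n}" using j by (auto simp: i_def)
  let ?M = "w_bar n (longest n \<circ> s_refl i)"
  have M: "?M \<in> carrier (SL n)"
    by (rule w_bar_SL[OF permutes_compose[OF s_refl_permutes[OF i] longest]])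
  \<comment> \<open>Splitting \<open>?W\<close> into \<open>?M\<close> times
    \<open>s_bar n i\<close> leaves \<open>s_bar n i\<close> in front of \<open>L\<close> once
    \<open>?M\<close> is cancelled.\<close>
  have "?\<Theta> = ?M \<otimes>\<^bsub>SL n\<^esub> (s_bar n i \<otimes>\<^bsub>SL n\<^esub> L \<otimes>\<^bsub>SL n\<^esub> B)"
    unfolding Theta' w_bar_longest_s_refl[OF i, symmetric] mult
    using M SL s[OF i] by (simp add: G.m_assoc)
  moreover have "s_bar n i \<otimes>\<^bsub>SL n\<^esub> L \<otimes>\<^bsub>SL n\<^esub> B \<in> carrier (SL n)" using SL s[OF i] by simp
  moreover have "w_bar n id = \<one>\<^bsub>SL n\<^esub>" unfolding w_bar_id one_SL ..
  ultimately have "inv\<^bsub>SL n\<^esub> ?M * ?\<Theta> * w_bar n id = s_bar n i * L * B"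
    "s_bar n i * L * B \<in> carrier (SL n)"
    unfolding mult using M by (simp_all add: G.m_assoc[symmetric])
  then have "gen_minor n (fund_weight i) (longest n \<circ> s_refl i) id ?\<Theta> =
      det (leading_block i (s_bar n i * L * B))"
    using i by (simp add: gen_minor_def principal_minor_fund_weight)
  also have "\<dots> = det (leading_block i (s_bar n i * L)) * det (leading_block i B)"
    using U_plusD(4)[OF B] i
    by (intro det_leading_block_mult[OF mult_carrier_mat[OF carrier_s_bar U_minusD(1)[OF L]] U_plusD(1)[OF B]]) auto
  also have "\<dots> = - L $$ (i, i - 1)"
    using det_leading_block_U_plus[OF B] det_leading_block_s_bar_mult[OF L i] i by simp
  also have "\<dots> = A $$ (j - 1, j)"
  proof -
    have "odd (i + (i - 1))" "n - i = j - 1" "n - (i - 1) = j" using i j by (auto simp: i_def)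
    moreover have "L $$ (p, q) = (-1) ^ (p + q) * A $$ (n - p, n - q)" if "p \<le> n" "q \<le> n" for p q
      using that by (simp add: L_def)
    then have "L $$ (i, i - 1) = (-1) ^ (i + (i - 1)) * A $$ (n - i, n - (i - 1))"
      using i by (metis atLeastAtMost_iff diff_le_self le_trans)
    ultimately show ?thesis by (simp only: uminus_power_if if_False) simp
  qed
  \<comment> \<open>Substituting \<open>k = j - 1 - t\<close> makes the block index
    \<open>j - k\<close>; the summand \<open>k = 0\<close> has numerator 1 by the convention for
    \<open>a\<close> and becomes the isolated term \<open>1 / c j 1\<close>.\<close>
  also have "\<dots> = (\<Sum>k\<le>j - 1. a (n - (j - 1 - k)) k / a (n - (j - 1 - k)) (k + 1))"
  proof -
    obtain q where q: "j = Suc q" using j by (cases j) auto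
    show ?thesis unfolding Asup unfolding q
      by (rule sum.reindex_bij_witness[of _ "\<lambda>k. q - k" "\<lambda>k. q - k"]) auto
  qed
  also have "\<dots> = (\<Sum>k\<in>insert 0 {1..j - 1}. a (n - (j - 1 - k)) k / a (n - (j - 1 - k)) (k + 1))"
    by (intro sum.cong) auto
  also have "\<dots> = 1 / c j 1 + (\<Sum>k = 1..j - 1. a (n - (j - 1 - k)) k / a (n - (j - 1 - k)) (k + 1))"
  proof -
    have "n + 1 - (n - (j - 1 - 0)) = j" using j by auto
    then show ?thesis by (subst sum.insert) (auto simp: a_def)
  qed
  also have "(\<Sum>k = 1..j - 1. a (n - (j - 1 - k)) k / a (n - (j - 1 - k)) (k + 1)) =
      (\<Sum>k = 1..j - 1. c (j - k) k / c (j - k) (k + 1))"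
  proof (rule sum.cong)
    fix k assume k: "k \<in> {1..j - 1}"
    then have "n + 1 - (n - (j - 1 - k)) = j - k" using j by auto
    then show "a (n - (j - 1 - k)) k / a (n - (j - 1 - k)) (k + 1) = c (j - k) k / c (j - k) (k + 1)"
      using k by (simp add: a_def)
  qed simp
  finally have second: "gen_minor n (fund_weight i) (longest n \<circ> s_refl i) id ?\<Theta>
      = 1 / c j 1 + (\<Sum>k = 1..j - 1. c (j - k) k / c (j - k) (k + 1))" .
  show ?thesis using first second unfolding i_def by blast
qed

end
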